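(* Let $K$ be a Henselian rank one valued field of equicharacteristic zero, considered as a structure in the three-sorted language $\mathcal{L}^{P}$ of Denef--Pas. Let $A \subset K^{n}$ and let $f: A \to \mathbb{P}^{1}(K)$ be an $\mathcal{L}^{P}$-definable (with parameters) function. Then $f$ is piecewise continuous, i.e. there is a finite partition of $A$ into $\mathcal{L}^{P}$-definable subsets $A_{1},\ldots,A_{s}$, each locally closed in $K^{n}$, such that the restriction $f|_{A_{i}}$ is continuous for each $i=1,\ldots,s$.
   Context: A rank one valued field is a field with a valuation $v$ whose value group $\Gamma$ embeds into $(\mathbb{R},+)$ as an ordered group; equicharacteristic zero means $K$ and its residue field $\Bbbk$ both have characteristic $0$; Henselian means the valuation ring $R$ satisfies Hensel's lemma. The Denef--Pas language $\mathcal{L}^{P}$ has three sorts: the valued field $K$-sort (with the language of rings), the value group $\Gamma$-sort (with any augmentation of the language of ordered abelian groups with $\infty$), and the residue field $\Bbbk$-sort (with any augmentation of the language of rings). The only symbols connecting the sorts are the valuation map $v: K \to \Gamma \cup \{\infty\}$ and an angular component map $\overline{ac}: K \to \Bbbk$, which is multiplicative, sends $0$ to $0$, and coincides with the residue map on units of $R$. "Definable" means definable with parameters. $K^{n}$ carries the product topology of the valuation topology on $K$ (the $K$-topology), and $\mathbb{P}^{1}(K)$ (the projective line over $K$) carries the topology induced by the valuation topology via its standard affine charts; a subset is locally closed if it is the intersection of an open set and a closed set. *)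

theory Defs
  imports "HOL-Computational_Algebra.Polynomial" "HOL-Library.Extended_Real"
begin

text \<open>The valued field is a type 'k of class field_char_0; the valuation is
  v :: 'k => ereal (value group inside the reals, v 0 = infinity);
  the residue field is a type 'r of class field_char_0, with residue map res
  defined on the valuation ring R = {x. v x >= 0}; ac is the angular component.\<close>

definition valuation_ring :: "('k::field \<Rightarrow> ereal) \<Rightarrow> 'k set" where
  "valuation_ring v = {x. v x \<ge> 0}"

definition rank_one_valuation :: "('k::field \<Rightarrow> ereal) \<Rightarrow> bool" where
  "rank_one_valuation v \<longleftrightarrow>
     (\<forall>x. v x = \<infinity> \<longleftrightarrow> x = 0) \<and>
     (\<forall>x. x \<noteq> 0 \<longrightarrow> (\<exists>r::real. v x = ereal r)) \<and>
     (\<forall>x y. v (x * y) = v x + v y) \<and>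
     (\<forall>x y. min (v x) (v y) \<le> v (x + y)) \<and>
     (\<exists>x. x \<noteq> 0 \<and> v x \<noteq> 0)"

definition residue_map :: "('k::field \<Rightarrow> ereal) \<Rightarrow> ('k \<Rightarrow> 'r::field) \<Rightarrow> bool" where
  "residue_map v res \<longleftrightarrow>
     res ` valuation_ring v = UNIV \<and>
     res 1 = 1 \<and>
     (\<forall>x\<in>valuation_ring v. \<forall>y\<in>valuation_ring v.
        res (x + y) = res x + res y \<and> res (x * y) = res x * res y) \<and>
     (\<forall>x\<in>valuation_ring v. res x = 0 \<longleftrightarrow> v x > 0)"

definition angular_component ::
  "('k::field \<Rightarrow> ereal) \<Rightarrow> ('k \<Rightarrow> 'r::field) \<Rightarrow> ('k \<Rightarrow> 'r) \<Rightarrow> bool" where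
  "angular_component v res ac \<longleftrightarrow>
     ac 0 = 0 \<and> (\<forall>x y. ac (x * y) = ac x * ac y) \<and>
     (\<forall>u. v u = 0 \<longrightarrow> ac u = res u)"

definition henselian :: "('k::field \<Rightarrow> ereal) \<Rightarrow> bool" where
  "henselian v \<longleftrightarrow>
     (\<forall>p a. lead_coeff p = 1 \<and> (\<forall>i. coeff p i \<in> valuation_ring v) \<and>
        a \<in> valuation_ring v \<and> v (poly p a) > 0 \<and> v (poly (pderiv p) a) = 0
        \<longrightarrow> (\<exists>b. poly p b = 0 \<and> v (b - a) > 0))"

definition henselian_rank_one_ac_field ::
  "('k::field_char_0 \<Rightarrow> ereal) \<Rightarrow> ('k \<Rightarrow> 'r::field_char_0) \<Rightarrow> ('k \<Rightarrow> 'r) \<Rightarrow> bool" where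
  "henselian_rank_one_ac_field v res ac \<longleftrightarrow>
     rank_one_valuation v \<and> residue_map v res \<and> angular_component v res ac \<and> henselian v"

datatype kterm = KVar nat | KZero | KOne | KAdd kterm kterm | KNeg kterm | KMul kterm kterm

datatype gterm = GVar nat | GZero | GInf | GAdd gterm gterm | GVal kterm

datatype rterm = RVar nat | RZero | ROne | RAdd rterm rterm | RNeg rterm | RMul rterm rterm
  | RAc kterm

text \<open>Formulas. The augmentations of the value group and residue field languages are
  given by arbitrary families of extra relation symbols indexed by 'i and 'j.\<close>
datatype ('i, 'j) dpfm =
    FKEq kterm kterm
  | FGEq gterm gterm
  | FGLess gterm gterm
  | FREq rterm rterm
  | FGRel 'i "gterm list"
  | FRRel 'j "rterm list"
  | FNot "('i, 'j) dpfm"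
  | FAnd "('i, 'j) dpfm" "('i, 'j) dpfm"
  | FExK nat "('i, 'j) dpfm"
  | FExG nat "('i, 'j) dpfm"
  | FExR nat "('i, 'j) dpfm"

primrec evalK :: "(nat \<Rightarrow> 'k::field) \<Rightarrow> kterm \<Rightarrow> 'k" where
  "evalK e (KVar i) = e i"
| "evalK e KZero = 0"
| "evalK e KOne = 1"
| "evalK e (KAdd s t) = evalK e s + evalK e t"
| "evalK e (KNeg s) = - evalK e s"
| "evalK e (KMul s t) = evalK e s * evalK e t"

primrec evalG :: "('k::field \<Rightarrow> ereal) \<Rightarrow> (nat \<Rightarrow> 'k) \<Rightarrow> (nat \<Rightarrow> ereal) \<Rightarrow> gterm \<Rightarrow> ereal" where
  "evalG v eK eG (GVar i) = eG i"
| "evalG v eK eG GZero = 0"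
| "evalG v eK eG GInf = \<infinity>"
| "evalG v eK eG (GAdd s t) = evalG v eK eG s + evalG v eK eG t"
| "evalG v eK eG (GVal t) = v (evalK eK t)"

primrec evalR :: "('k::field \<Rightarrow> 'r::field) \<Rightarrow> (nat \<Rightarrow> 'k) \<Rightarrow> (nat \<Rightarrow> 'r) \<Rightarrow> rterm \<Rightarrow> 'r" where
  "evalR ac eK eR (RVar i) = eR i"
| "evalR ac eK eR RZero = 0"
| "evalR ac eK eR ROne = 1"
| "evalR ac eK eR (RAdd s t) = evalR ac eK eR s + evalR ac eK eR t"
| "evalR ac eK eR (RNeg s) = - evalR ac eK eR s"
| "evalR ac eK eR (RMul s t) = evalR ac eK eR s * evalR ac eK eR t"
| "evalR ac eK eR (RAc t) = ac (evalK eK t)"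

text \<open>Satisfaction. The value-group sort ranges over the value group together with
  infinity, i.e. over the image of v; the residue field sort is the type 'r.\<close>
primrec dpsat ::
  "('k::field \<Rightarrow> ereal) \<Rightarrow> ('k \<Rightarrow> 'r::field) \<Rightarrow> ('i \<Rightarrow> ereal list set) \<Rightarrow> ('j \<Rightarrow> 'r list set)
   \<Rightarrow> ('i, 'j) dpfm \<Rightarrow> (nat \<Rightarrow> 'k) \<Rightarrow> (nat \<Rightarrow> ereal) \<Rightarrow> (nat \<Rightarrow> 'r) \<Rightarrow> bool" where
  "dpsat v ac relG relR (FKEq s t) eK eG eR = (evalK eK s = evalK eK t)"
| "dpsat v ac relG relR (FGEq s t) eK eG eR = (evalG v eK eG s = evalG v eK eG t)"
| "dpsat v ac relG relR (FGLess s t) eK eG eR = (evalG v eK eG s < evalG v eK eG t)"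
| "dpsat v ac relG relR (FREq s t) eK eG eR = (evalR ac eK eR s = evalR ac eK eR t)"
| "dpsat v ac relG relR (FGRel i ts) eK eG eR = (map (evalG v eK eG) ts \<in> relG i)"
| "dpsat v ac relG relR (FRRel j ts) eK eG eR = (map (evalR ac eK eR) ts \<in> relR j)"
| "dpsat v ac relG relR (FNot \<phi>) eK eG eR = (\<not> dpsat v ac relG relR \<phi> eK eG eR)"
| "dpsat v ac relG relR (FAnd \<phi> \<psi>) eK eG eR =
     (dpsat v ac relG relR \<phi> eK eG eR \<and> dpsat v ac relG relR \<psi> eK eG eR)"
| "dpsat v ac relG relR (FExK n \<phi>) eK eG eR = (\<exists>a. dpsat v ac relG relR \<phi> (eK(n := a)) eG eR)"
| "dpsat v ac relG relR (FExG n \<phi>) eK eG eR =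
     (\<exists>g\<in>range v. dpsat v ac relG relR \<phi> eK (eG(n := g)) eR)"
| "dpsat v ac relG relR (FExR n \<phi>) eK eG eR = (\<exists>c. dpsat v ac relG relR \<phi> eK eG (eR(n := c)))"

text \<open>K^n is represented as the set of lists of length n. A subset of K^n is definable
  with parameters if it is defined by a formula in which the valued-field variables
  0..n-1 stand for the coordinates and all remaining free variables are assigned
  parameters (value-group parameters lie in the value group together with infinity).\<close>
definition Kn :: "nat \<Rightarrow> 'k list set" where
  "Kn n = {xs. length xs = n}"

definition dp_definable ::
  "('k::field \<Rightarrow> ereal) \<Rightarrow> ('k \<Rightarrow> 'r::field) \<Rightarrow> ('i \<Rightarrow> ereal list set) \<Rightarrow> ('j \<Rightarrow> 'r list set)
   \<Rightarrow> nat \<Rightarrow> 'k list set \<Rightarrow> bool" where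
  "dp_definable v ac relG relR n A \<longleftrightarrow>
     (\<exists>(\<phi> :: ('i, 'j) dpfm) pK pG pR. range pG \<subseteq> range v \<and>
        A = {xs \<in> Kn n. dpsat v ac relG relR \<phi> (\<lambda>i. if i < n then xs ! i else pK i) pG pR})"

definition Kn_open :: "('k::field \<Rightarrow> ereal) \<Rightarrow> nat \<Rightarrow> 'k list set \<Rightarrow> bool" where
  "Kn_open v n U \<longleftrightarrow> U \<subseteq> Kn n \<and>
     (\<forall>xs\<in>U. \<exists>\<gamma>::real. \<forall>ys\<in>Kn n. (\<forall>i<n. v (ys ! i - xs ! i) > ereal \<gamma>) \<longrightarrow> ys \<in> U)"

definition Kn_closed :: "('k::field \<Rightarrow> ereal) \<Rightarrow> nat \<Rightarrow> 'k list set \<Rightarrow> bool" where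
  "Kn_closed v n C \<longleftrightarrow> C \<subseteq> Kn n \<and> Kn_open v n (Kn n - C)"

definition locally_closed :: "('k::field \<Rightarrow> ereal) \<Rightarrow> nat \<Rightarrow> 'k list set \<Rightarrow> bool" where
  "locally_closed v n A \<longleftrightarrow> (\<exists>U C. Kn_open v n U \<and> Kn_closed v n C \<and> A = U \<inter> C)"

text \<open>Projective line P^1(K) as 'k option: Some a is the point (a:1), None is the point (1:0).
  A set is open iff its preimages under the two standard affine charts are open in K.\<close>
definition chart_inf :: "'k::field \<Rightarrow> 'k option" where
  "chart_inf b = (if b = 0 then None else Some (inverse b))"

definition K_open :: "('k::field \<Rightarrow> ereal) \<Rightarrow> 'k set \<Rightarrow> bool" where
  "K_open v U \<longleftrightarrow> (\<forall>a\<in>U. \<exists>\<gamma>::real. \<forall>b. v (b - a) > ereal \<gamma> \<longrightarrow> b \<in> U)"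

definition P1_open :: "('k::field \<Rightarrow> ereal) \<Rightarrow> 'k option set \<Rightarrow> bool" where
  "P1_open v W \<longleftrightarrow> K_open v {a. Some a \<in> W} \<and> K_open v {b. chart_inf b \<in> W}"

definition continuous_on_P1 ::
  "('k::field \<Rightarrow> ereal) \<Rightarrow> nat \<Rightarrow> 'k list set \<Rightarrow> ('k list \<Rightarrow> 'k option) \<Rightarrow> bool" where
  "continuous_on_P1 v n B f \<longleftrightarrow>
     (\<forall>W. P1_open v W \<longrightarrow> (\<exists>U. Kn_open v n U \<and> {xs \<in> B. f xs \<in> W} = U \<inter> B))"

text \<open>A function f : A \<rightarrow> P^1(K) is definable if, covering P^1(K) by the point at infinity
  and the affine chart K, both the set where f is infinite and the graph of the affine part
  (as a subset of K^(n+1)) are definable.\<close>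
definition dp_definable_P1_fun ::
  "('k::field \<Rightarrow> ereal) \<Rightarrow> ('k \<Rightarrow> 'r::field) \<Rightarrow> ('i \<Rightarrow> ereal list set) \<Rightarrow> ('j \<Rightarrow> 'r list set)
   \<Rightarrow> nat \<Rightarrow> 'k list set \<Rightarrow> ('k list \<Rightarrow> 'k option) \<Rightarrow> bool" where
  "dp_definable_P1_fun v ac relG relR n A f \<longleftrightarrow>
     dp_definable v ac relG relR n {xs \<in> A. f xs = None} \<and>
     dp_definable v ac relG relR (Suc n) {xs @ [a] | xs a. xs \<in> A \<and> f xs = Some a}"

end

theory Submission
  imports Defs "HOL-Library.Disjoint_Sets"
begin

text \<open>
  Write \<open>sim a b\<close> when \<open>a\<close> and \<open>b\<close> have the same leading term; this forces equal valuations
  and angular components. By Hensel's lemma, if \<open>b\<close> is a root, closest to \<open>y\<close>, among all roots of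
  finitely many polynomials and their derivatives, then the Taylor expansions at \<open>b\<close> evaluated at \<open>y\<close>
  have no cancellation of leading terms. Hence the leading terms of the polynomials at \<open>y\<close> are determined
  by those of the derivatives at \<open>b\<close> and that of \<open>y - b\<close>, and roots are treated by induction on the
  degree with pseudo-remainders. This eliminates field quantifiers semantically: the truth of a
  formula depends only on the leading terms of finitely many polynomials, for whatever extra relations on
  the value group and the residue field. So a definable set is relatively clopen in each piece on which the
  zero pattern of these polynomials is constant. For a definable function \<open>f\<close> the value \<open>f x\<close>, being
  isolated in its fibre, is a root of one of the polynomials; where the zero pattern of enough polynomials
  at \<open>(x, f x)\<close> is constant it is a simple root of one of minimal degree, hence moves
  continuously. The zero patterns only use the formula of \<open>f\<close> itself, so the pieces are definable.
\<close>

section \<open>Valuations and Hensel's lemma\<close>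

text \<open>Nothing in the definition of a function \<open>f\<close> compares \<open>f x\<close>
  with a nearby root; the link is uniqueness of the value. If \<open>c\<close> is close to
  \<open>f x0\<close> and the relevant polynomials have the same leading terms at
  \<open>(x, c)\<close> as at \<open>(x0, f x0)\<close>, then \<open>(x, c)\<close> satisfies the
  formula of the graph, so \<open>c = f x\<close>. Polynomials that do not vanish at
  \<open>(x0, f x0)\<close> keep their leading terms nearby by mere continuity; only the vanishing
  ones can spoil the argument, which is why zero patterns are all that has to be fixed on a piece.
  Isolation works the same way: a point that is none of the roots can be displaced a little without
  changing any leading term, so no formula singles it out. Residue characteristic zero makes
  factorials units, so that derivatives and Taylor coefficients have equal values.\<close>

text \<open>Residue characteristic zero is expressed through the values of integers, so leading
  terms can be studied without a residue field or an angular component.\<close>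

locale henselian_valuation =
  fixes v :: "'k::field_char_0 \<Rightarrow> ereal"
  assumes rank_one: "rank_one_valuation v"
    and residue_char_0: "n > 0 \<Longrightarrow> v (of_nat n) = 0"
    and hensel: "henselian v"
begin

lemma v_eq_infinity [simp]: "v x = \<infinity> \<longleftrightarrow> x = 0"
  using rank_one by (auto simp: rank_one_valuation_def)

lemma v_0 [simp]: "v 0 = \<infinity>"
  by simp

lemma v_finite: "x \<noteq> 0 \<Longrightarrow> \<exists>r::real. v x = ereal r"
  using rank_one by (auto simp: rank_one_valuation_def)

lemma v_neq_minf [simp]: "v x \<noteq> -\<infinity>"
  using v_finite[of x] by (cases "x = 0") auto

lemma v_less_infinity [simp]: "v x < \<infinity> \<longleftrightarrow> x \<noteq> 0"
  by (simp add: less_top[symmetric] top_ereal_def)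

lemma v_mult: "v (x * y) = v x + v y"
  using rank_one by (auto simp: rank_one_valuation_def)

lemma v_add: "min (v x) (v y) \<le> v (x + y)"
  using rank_one by (auto simp: rank_one_valuation_def)

lemma v_1 [simp]: "v 1 = 0"
  using residue_char_0[of 1] by simp

lemma v_minus [simp]: "v (- x) = v x"
proof -
  have "v (-1) + v (-1) = 0"
    by (simp flip: v_mult)
  then have "v (-1) = 0"
    using v_finite[of "-1"] by auto
  then show ?thesis
    using v_mult[of "-1" x] by simp
qed

lemma v_diff_commute: "v (x - y) = v (y - x)"
  using v_minus[of "x - y"] by simp

lemma v_add_ge: "m \<le> v x \<Longrightarrow> m \<le> v y \<Longrightarrow> m \<le> v (x + y)"
  using v_add[of x y] by (auto simp: min_def split: if_splits)

lemma v_add_gt: "m < v x \<Longrightarrow> m < v y \<Longrightarrow> m < v (x + y)"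
  using v_add[of x y] by (auto simp: min_def split: if_splits)

lemma v_diff_ge: "m \<le> v x \<Longrightarrow> m \<le> v y \<Longrightarrow> m \<le> v (x - y)"
  using v_add_ge[of m x "-y"] by simp

lemma v_eq_if_close: "v (x - y) > v x \<Longrightarrow> v y = v x"
  using v_add_gt[of "v x" "x - y" y] v_diff_ge[of "v x" x "x - y"]
  by (cases "v x < v y") auto

lemma v_inverse: "x \<noteq> 0 \<Longrightarrow> v (inverse x) = - v x"
proof -
  assume x: "x \<noteq> 0"
  then have "v x + v (inverse x) = 0"
    by (simp flip: v_mult)
  then show ?thesis
    using v_finite[of x] v_finite[of "inverse x"] x by auto
qed

lemma v_divide: "y \<noteq> 0 \<Longrightarrow> v (x / y) = v x - v y"
  by (simp add: divide_inverse v_mult v_inverse minus_ereal_def)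

lemma v_power: "x \<noteq> 0 \<Longrightarrow> v x = ereal r \<Longrightarrow> v (x ^ n) = ereal (n * r)"
  by (induction n) (auto simp: v_mult algebra_simps zero_ereal_def)

lemma v_fact [simp]: "v (fact n) = 0"
  using residue_char_0[of "fact n"] by simp

lemma v_cancel_less: "a \<noteq> 0 \<Longrightarrow> v (a * x) < v (a * y) \<longleftrightarrow> v x < v y"
  using v_finite[of a] v_neq_minf[of x] v_neq_minf[of y]
  by (cases "v x"; cases "v y") (auto simp: v_mult)

lemma v_mult_ge: "m \<le> v x \<Longrightarrow> 0 \<le> v y \<Longrightarrow> m \<le> v (x * y)"
  using add_mono[of m "v x" 0 "v y"] by (simp add: v_mult)

lemma v_mult_gt: "m < v x \<Longrightarrow> 0 \<le> v y \<Longrightarrow> m < v (x * y)"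
  using add_mono[of "v x" "v x" 0 "v y"] by (simp add: v_mult less_le_trans)

text \<open>Up to inversion a nontrivial value is positive, and by the Archimedean property its
  multiples pass every real bound. Hence real radii give the same topology as radii from the value
  group.\<close>

lemma exists_v_gt: "\<exists>s. s \<noteq> 0 \<and> v s > ereal \<gamma>"
proof -
  obtain x where x: "x \<noteq> 0" "v x \<noteq> 0"
    using rank_one by (auto simp: rank_one_valuation_def)
  obtain y r where y: "y \<noteq> 0" "v y = ereal r" "r > 0"
  proof -
    obtain r where r: "v x = ereal r"
      using v_finite x by blast
    show thesis
    proof (cases "r > 0")
      case True then show thesis using that[of x r] x r by auto
    next
      case False
      then have "-r > 0" using r x by (auto simp: zero_ereal_def)
      then show thesis using that[of "inverse x" "-r"] x r v_inverse[of x] by auto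
    qed
  qed
  obtain n :: nat where "\<gamma> < n * r"
    using reals_Archimedean3[OF y(3)] by blast
  then show ?thesis
    using y v_power[of y r n] by (intro exI[of _ "y ^ n"]) auto
qed

section \<open>Leading terms\<close>

text \<open>On nonzero elements this is equality in \<open>RV\<close>, the multiplicative group
  modulo the one-units. The disjunct \<open>a = b\<close> only matters for \<open>a = 0\<close>:
  zero is related to itself alone.\<close>

definition sim :: "'k \<Rightarrow> 'k \<Rightarrow> bool" where
  "sim a b \<longleftrightarrow> a = b \<or> v (a - b) > v a"

lemma sim_refl [simp]: "sim a a"
  by (simp add: sim_def)

lemma sim_v: "sim a b \<Longrightarrow> v b = v a"
  using v_eq_if_close[of a b] by (auto simp: sim_def)

lemma sim_sym: "sim a b \<Longrightarrow> sim b a"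
  using sim_v[of a b] by (auto simp: sim_def v_diff_commute[of b a])

lemma sim_trans: "sim a b \<Longrightarrow> sim b c \<Longrightarrow> sim a c"
  using v_add_gt[of "v a" "a - b" "b - c"] sim_v[of a b] by (auto simp: sim_def)

lemma sim_0: "sim a b \<Longrightarrow> a = 0 \<longleftrightarrow> b = 0"
  using sim_v[of a b] v_eq_infinity[of a] v_eq_infinity[of b] by simp

lemma sim_mult: "sim a b \<Longrightarrow> sim c d \<Longrightarrow> sim (a * c) (b * d)"
proof (cases "a = 0 \<or> c = 0")
  case True
  assume "sim a b" "sim c d"
  then have "a * c = b * d" using True sim_0 by auto
  then show ?thesis by simp
next
  case False
  assume ab: "sim a b" and cd: "sim c d"
  have b0: "b \<noteq> 0" using False ab sim_0 by blast
  have 1: "v (a * c) < v (a * (c - d))" if "c \<noteq> d"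
    using cd that False by (simp add: sim_def v_cancel_less)
  have 2: "v (a * c) < v (d * (a - b))" if "a \<noteq> b"
  proof -
    have "v (d * a) < v (d * (a - b))"
      using ab that False cd sim_0[of c d] by (auto simp: sim_def v_cancel_less)
    then show ?thesis using sim_v[OF cd] by (simp add: v_mult add.commute)
  qed
  have "a * c - b * d = a * (c - d) + d * (a - b)"
    by (simp add: algebra_simps)
  then show ?thesis
    using 1 2 v_add_gt[of "v (a * c)" "a * (c - d)" "d * (a - b)"]
    by (cases "a = b"; cases "c = d") (auto simp: sim_def)
qed

lemma sim_power: "sim a b \<Longrightarrow> sim (a ^ n) (b ^ n)"
  by (induction n) (simp_all add: sim_mult)

lemma sim_inverse: "sim a b \<Longrightarrow> sim (inverse a) (inverse b)"
proof (cases "a = 0 \<or> a = b")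
  case True
  assume "sim a b"
  then show ?thesis using sim_0[of a b] True by auto
next
  case False
  assume ab: "sim a b"
  then have b: "b \<noteq> 0" using False sim_0 by blast
  have "v (a * b * inverse a) < v (a * b * (inverse a - inverse b))"
  proof -
    have *: "a * b * inverse a = b" "a * b * (inverse a - inverse b) = b - a"
      using False b by (auto simp: field_simps)
    show ?thesis
      unfolding * using ab False sim_v[OF ab] by (simp add: sim_def v_diff_commute[of b a])
  qed
  then show ?thesis using False b by (simp add: sim_def v_cancel_less)
qed

lemma sim_cancel: "sim a b \<Longrightarrow> a \<noteq> 0 \<Longrightarrow> sim (a * c) (b * d) \<Longrightarrow> sim c d"
  using sim_mult[OF sim_inverse, of a b "a * c" "b * d"] sim_0[of a b]
  by (simp add: field_simps)

section \<open>Polynomials, Taylor coefficients and Hensel's lemma without monicity\<close>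

lemma v_poly_ge: "(\<And>i. m \<le> v (coeff p i)) \<Longrightarrow> 0 \<le> v x \<Longrightarrow> m \<le> v (poly p x)"
proof (induction p)
  case (pCons a p)
  have "m \<le> v (coeff p i)" for i
    using pCons.prems(1)[of "Suc i"] by simp
  then have "m \<le> v (poly p x * x)"
    using pCons by (intro v_mult_ge) auto
  then show ?case
    using pCons.prems(1)[of 0] by (auto intro!: v_add_ge simp: mult.commute)
qed simp

lemma v_poly_gt: "(\<And>i. m < v (coeff p i)) \<Longrightarrow> 0 \<le> v x \<Longrightarrow> m < v (poly p x)"
proof (induction p)
  case (pCons a p)
  have "m < v (coeff p i)" for i
    using pCons.prems(1)[of "Suc i"] by simp
  then have "m < v (poly p x * x)"
    using pCons by (intro v_mult_gt) auto
  then show ?case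
    using pCons.prems(1)[of 0] by (auto intro!: v_add_gt simp: mult.commute)
qed simp

text \<open>The factor \<open>i + 1\<close> is a unit by residue characteristic zero, so bounds on
  coefficients pass to all derivatives without loss.\<close>

lemma v_coeff_pderiv: "v (coeff (pderiv p) i) = v (coeff p (Suc i))"
  using residue_char_0[of "Suc i"] by (simp add: coeff_pderiv v_mult del: of_nat_Suc)

lemma v_coeff_higher_pderiv_ge:
  "(\<And>i. m \<le> v (coeff p i)) \<Longrightarrow> m \<le> v (coeff ((pderiv ^^ j) p) i)"
  by (induction j arbitrary: i) (auto simp: v_coeff_pderiv)

lemma v_coeff_higher_pderiv_gt:
  "(\<And>i. m < v (coeff p i)) \<Longrightarrow> m < v (coeff ((pderiv ^^ j) p) i)"
  by (induction j arbitrary: i) (auto simp: v_coeff_pderiv)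

lemma higher_pderiv_pcompose_linear:
  fixes p :: "'k poly"
  shows "(pderiv ^^ j) (p \<circ>\<^sub>p [:b, t:]) = smult (t ^ j) (((pderiv ^^ j) p) \<circ>\<^sub>p [:b, t:])"
  by (induction j) (simp_all add: pderiv_smult pderiv_pcompose pderiv_pCons mult_ac)

text \<open>Substituting \<open>b + t * X\<close> stores the Taylor terms of \<open>p\<close> at
  \<open>b\<close> as coefficients, so \<open>p\<close> at \<open>b + t\<close> becomes a value at 1
  and cancellation becomes a comparison with coefficients.\<close>

lemma coeff_taylor:
  fixes p :: "'k poly"
  shows "coeff (p \<circ>\<^sub>p [:b, t:]) j = poly ((pderiv ^^ j) p) b / fact j * t ^ j"
proof -
  have higher: "coeff ((pderiv ^^ j) q) 0 = fact j * coeff q j" for q :: "'k poly" and j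
  proof (induction j arbitrary: q)
    case (Suc j)
    show ?case
      using Suc[of "pderiv q"] by (simp add: funpow_swap1 coeff_pderiv algebra_simps)
  qed simp
  have "fact j * coeff (p \<circ>\<^sub>p [:b, t:]) j = t ^ j * poly ((pderiv ^^ j) p) b"
    unfolding higher[symmetric] higher_pderiv_pcompose_linear
    by (simp add: poly_0_coeff_0[symmetric] poly_pcompose)
  then show ?thesis by (simp add: field_simps)
qed

text \<open>The hypothesis \<open>henselian\<close> speaks of monic polynomials only. The
  substitution \<open>y = w * U\<close> with \<open>w = c 0 / c 1\<close> turns
  \<open>p (a + y) / c 0\<close> into \<open>1 + U\<close> plus terms with coefficients of positive
  value. Reversed, this is monic and reduces to \<open>Z ^ N + Z ^ (N - 1)\<close>, which has the
  simple root \<open>-1\<close>.\<close>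

lemma hensel_nonmonic:
  assumes R: "\<And>i. 0 \<le> v (coeff p i)" and a: "0 \<le> v a"
    and p: "v (poly p a) > 0" and dp: "v (poly (pderiv p) a) = 0"
  shows "\<exists>b. poly p b = 0 \<and> v (b - a) > 0"
proof (cases "poly p a = 0")
  case True
  then show ?thesis by (intro exI[of _ a]) simp
next
  case False
  define c where "c j = coeff (p \<circ>\<^sub>p [:a, 1:]) j" for j
  have c_ge: "0 \<le> v (c j)" for j
    using R a unfolding c_def coeff_taylor
    by (simp add: v_divide v_poly_ge v_coeff_higher_pderiv_ge)
  have c0: "c 0 = poly p a" and c1: "c 1 = poly (pderiv p) a"
    unfolding c_def coeff_taylor by auto
  have c1_nz: "c 1 \<noteq> 0" using dp c1 by auto
  \<comment> \<open>One more than the degree makes \<open>N\<close> positive without further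
    argument; the padding coefficient is 0 and only gives the reversed polynomial the harmless root
    0.\<close>
  define N where "N = Suc (degree (p \<circ>\<^sub>p [:a, 1:]))"
  have expand: "poly p (a + y) = (\<Sum>j\<le>N. c j * y ^ j)" for y
  proof -
    have "poly p (a + y) = poly (p \<circ>\<^sub>p [:a, 1:]) y"
      by (simp add: poly_pcompose)
    also have "\<dots> = (\<Sum>j\<le>N. c j * y ^ j)"
      unfolding poly_altdef c_def N_def by (simp add: coeff_eq_0)
    finally show ?thesis .
  qed
  \<comment> \<open>Up to sign the Newton step at \<open>a\<close>; it makes the constant and the
    linear coefficient after rescaling both equal to 1.\<close>
  define w where "w = c 0 / c 1"
  have vw: "v w > 0" unfolding w_def using c1_nz p dp c0 c1 by (simp add: v_divide)
  have w0: "w \<noteq> 0" unfolding w_def using False c0 c1_nz by simp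
  define e where "e j = c j * w ^ j / c 0" for j
  have e0: "e 0 = 1" and e1: "e 1 = 1"
    unfolding e_def w_def using False c0 c1_nz by auto
  have e_gt: "v (e (Suc (Suc j))) > 0" for j
  proof -
    have "e (Suc (Suc j)) = w * (w ^ j * c (Suc (Suc j)) / c 1)"
      unfolding e_def w_def using False c0 c1_nz by (simp add: field_simps)
    moreover have "0 \<le> v (w ^ j * c (Suc (Suc j)) / c 1)"
    proof -
      have "0 \<le> v (w ^ j)" using vw by (induction j) (auto simp: v_mult)
      then show ?thesis using c_ge dp c1 c1_nz by (simp add: v_divide v_mult)
    qed
    ultimately show ?thesis using vw by (metis v_mult_gt)
  qed
  \<comment> \<open>Reversing the polynomial \<open>\<Sum>j. e j * U ^ j\<close> makes it monic.\<close>
  define Q where "Q = (\<Sum>j\<le>N. monom (e j) (N - j))"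
  have coeff_Q: "coeff Q i = (if i \<le> N then e (N - i) else 0)" for i
  proof -
    have "coeff Q i = (\<Sum>j\<le>N. if j = N - i \<and> i \<le> N then e j else 0)"
      unfolding Q_def coeff_sum by (intro sum.cong) (auto simp: coeff_monom)
    also have "\<dots> = (if i \<le> N then e (N - i) else 0)"
      by auto
    finally show ?thesis .
  qed
  have lead: "lead_coeff Q = 1"
  proof -
    have "degree Q = N"
      by (rule antisym, rule degree_le) (auto simp: coeff_Q e0 intro!: le_degree)
    then show ?thesis by (simp add: coeff_Q e0)
  qed
  obtain N' where N': "N = Suc N'" unfolding N_def by blast
  define E where "E = Q - monom 1 N - monom 1 N'"
  have E_gt: "0 < v (coeff E i)" for i
  proof (cases "i < N'")
    case True
    then obtain j where "N - i = Suc (Suc j)" 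
      by (metis N' Suc_diff_le less_imp_le_nat Suc_diff_Suc)
    then show ?thesis using True e_gt[of j] by (simp add: E_def coeff_Q N')
  next
    case False
    then consider "i = N'" | "i = N" | "i > N" using N' by linarith
    then show ?thesis using e0 e1 by cases (auto simp: E_def coeff_Q N')
  qed
  have Q_eq: "Q = monom 1 N + monom 1 N' + E" by (simp add: E_def)
  have Q_ge: "0 \<le> v (coeff Q i)" for i
  proof -
    consider "i > N" | "i = N" | "i = N'" | "i < N'" using N' by linarith
    then show ?thesis
    proof cases
      case 4
      then show ?thesis using E_gt[of i] by (simp add: Q_eq N')
    qed (use e0 e1 in \<open>auto simp: coeff_Q N'\<close>)
  qed
  have "v (poly Q (-1)) > 0"
    using v_poly_gt[of 0 E "-1"] E_gt by (simp add: Q_eq poly_monom N')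
  moreover have "v (poly (pderiv Q) (-1)) = 0"
  proof -
    have "poly (pderiv Q) (-1) = (-1) ^ N' + poly (pderiv E) (-1)"
      by (cases N') (simp_all add: Q_eq pderiv_add pderiv_monom poly_monom N' algebra_simps)
    moreover have "v (poly (pderiv E) (-1)) > 0"
      using E_gt by (intro v_poly_gt) (auto simp: v_coeff_pderiv)
    moreover have "v ((-1) ^ N') = 0"
      by (cases "even N'") auto
    ultimately show ?thesis
      using v_eq_if_close[of "(-1) ^ N'" "poly (pderiv Q) (-1)"] by auto
  qed
  ultimately obtain z where z: "poly Q z = 0" "v (z - (-1)) > 0"
    using hensel lead Q_ge unfolding henselian_def valuation_ring_def
    by (metis mem_Collect_eq v_minus v_1 order_refl)
  have vz: "v z = 0"
    using v_eq_if_close[of "-1" z] z(2) by (metis v_1 v_diff_commute v_minus)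
  then have z0: "z \<noteq> 0" by auto
  \<comment> \<open>The reversal is undone by \<open>U = 1 / z\<close>; being close to
    \<open>-1\<close>, \<open>z\<close> is a unit.\<close>
  have "poly p (a + w / z) = c 0 * (\<Sum>j\<le>N. e j * (1 / z) ^ j)"
    unfolding expand sum_distrib_left e_def using False c0
    by (intro sum.cong) (auto simp: field_simps)
  also have "(\<Sum>j\<le>N. e j * (1 / z) ^ j) = poly Q z / z ^ N"
    unfolding Q_def poly_sum sum_divide_distrib poly_monom using z0
    by (intro sum.cong) (auto simp: power_diff field_simps)
  finally have "poly p (a + w / z) = 0" using z by simp
  moreover have "v (w / z) > 0" using vw vz z0 by (simp add: v_divide)
  ultimately show ?thesis by (intro exI[of _ "a + w / z"]) simp
qed

lemma hensel_scaled:
  assumes ge: "\<And>i. v u \<le> v (coeff p i)" and a: "0 \<le> v a" and u: "u \<noteq> 0"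
    and p: "v (poly p a) > v u" and dp: "v (poly (pderiv p) a) = v u"
  shows "\<exists>b. poly p b = 0 \<and> v (b - a) > 0"
proof -
  obtain r where r: "v u = ereal r" using v_finite u by blast
  have *: "0 \<le> v (x / u) \<longleftrightarrow> v u \<le> v x" "0 < v (x / u) \<longleftrightarrow> v u < v x" for x
    using r by (cases "v x"; simp add: v_divide u)+
  let ?q = "smult (1 / u) p"
  have "\<exists>b. poly ?q b = 0 \<and> v (b - a) > 0"
  proof (rule hensel_nonmonic)
    show "0 \<le> v (coeff ?q i)" for i using *(1)[of "coeff p i"] ge[of i] by simp
    show "v (poly ?q a) > 0" using *(2)[of "poly p a"] p by simp
    show "v (poly (pderiv ?q) a) = 0" using dp u r v_divide[OF u] by (simp add: pderiv_smult)
  qed (rule a)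
  then show ?thesis using u by auto
qed

section \<open>Taylor expansion at a closest root\<close>

text \<open>Each coefficient error has a value above that of the coefficient, hence above that of
  the sum at 1. Without the bound \<open>NC\<close> the errors could outweigh a sum with cancelling
  leading terms.\<close>

lemma sim_poly_1:
  assumes NC: "\<And>j. v (poly q 1) \<le> v (coeff q j)"
    and sim: "\<And>j. sim (coeff q j) (coeff q' j)"
  shows "sim (poly q 1) (poly q' 1)"
proof (cases "poly q 1 = 0")
  case True
  then have "coeff q j = 0" for j using NC[of j] by simp
  then have "q = 0" "q' = 0"
    using sim sim_0 by (metis leading_coeff_0_iff)+
  then show ?thesis by simp
next
  case False
  have "v (poly q 1) < v (coeff (q - q') j)" for j
    using NC[of j] sim[of j] False by (auto simp: sim_def)
  then have "v (poly q 1) < v (poly (q - q') 1)" by (intro v_poly_gt) auto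
  then show ?thesis by (simp add: sim_def)
qed

text \<open>A cancellation between the leading Taylor terms of \<open>p\<close> at \<open>b\<close> would, by Hensel's lemma applied to
  a suitable derivative, produce a root closer to \<open>b + t\<close> than \<open>b\<close> is.\<close>

lemma no_cancellation_at_closest_root:
  assumes t: "t \<noteq> 0"
    and closest: "\<And>m z. (pderiv ^^ m) p \<noteq> 0 \<Longrightarrow> poly ((pderiv ^^ m) p) z = 0 \<Longrightarrow>
      v (b + t - z) \<le> v t"
  shows "v (poly p (b + t)) \<le> v (coeff (p \<circ>\<^sub>p [:b, t:]) j)"
proof (rule ccontr)
  define q where "q = p \<circ>\<^sub>p [:b, t:]"
  assume "\<not> ?thesis"
  then have lt: "v (coeff q j) < v (poly q 1)"
    unfolding q_def poly_pcompose not_le by simp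
  obtain i0 where i0: "\<And>i. v (coeff q i0) \<le> v (coeff q i)"
  proof -
    let ?M = "(\<lambda>i. v (coeff q i)) ` {..degree q}"
    have "Min ?M \<in> ?M" by (intro Min_in) auto
    then obtain i0 where i0: "Min ?M = v (coeff q i0)" by (rule imageE)
    have "v (coeff q i0) \<le> v (coeff q i)" for i
    proof (cases "i \<le> degree q")
      case True
      then show ?thesis unfolding i0[symmetric] by (intro Min_le) auto
    next
      case False
      then show ?thesis by (simp add: coeff_eq_0)
    qed
    then show thesis by (rule that)
  qed
  define u where "u = coeff q i0"
  have u0: "u \<noteq> 0" using lt i0[of j] unfolding u_def by auto
  \<comment> \<open>Otherwise re-expanding at 1 and shifting back by \<open>-1\<close> would give
    \<open>u\<close>, itself a coefficient of \<open>q\<close>, a value above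
    \<open>v u\<close>.\<close>
  have "\<exists>m. v (poly ((pderiv ^^ m) q) 1) \<le> v u"
  proof (rule ccontr)
    assume "\<not> ?thesis"
    then have gt: "v u < v (coeff (q \<circ>\<^sub>p [:1, 1:]) m)" for m
      by (simp add: coeff_taylor v_divide not_le)
    have "v u < v (coeff ((q \<circ>\<^sub>p [:1, 1:]) \<circ>\<^sub>p [:-1, 1:]) i0)"
      unfolding coeff_taylor[of "q \<circ>\<^sub>p [:1, 1:]"] using gt
      by (auto simp: v_divide intro!: v_poly_gt v_coeff_higher_pderiv_gt)
    also have "(q \<circ>\<^sub>p [:1, 1:]) \<circ>\<^sub>p [:-1, 1:] = q"
      by (simp add: pcompose_assoc[symmetric] pcompose_pCons)
    finally show False by (simp add: u_def)
  qed
  then obtain m where m: "v (poly ((pderiv ^^ m) q) 1) \<le> v u"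
    and least: "\<And>i. i < m \<Longrightarrow> v u < v (poly ((pderiv ^^ i) q) 1)"
    using exists_least_iff[of "\<lambda>m. v (poly ((pderiv ^^ m) q) 1) \<le> v u"] by (auto simp: not_le)
  \<comment> \<open>The assumed cancellation enters here: \<open>q\<close> has value above
    \<open>v u\<close> at 1, so the least order is positive. The derivative one order earlier has
    value above \<open>v u\<close> at 1 while its own derivative has value exactly
    \<open>v u\<close>, which is the situation of Hensel's lemma.\<close>
  have "m \<noteq> 0" using m lt i0[of j] unfolding u_def by (metis funpow_0 leD le_less_trans)
  then obtain k where k: "m = Suc k" by (cases m) auto
  let ?s = "(pderiv ^^ k) q"
  have ge: "v u \<le> v (coeff ?s i)" for i
    using i0 unfolding u_def by (intro v_coeff_higher_pderiv_ge)
  have deriv_le: "v (poly (pderiv ?s) 1) \<le> v u" using m k by simp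
  moreover have "v u \<le> v (poly (pderiv ?s) 1)"
    using ge by (intro v_poly_ge) (auto simp: v_coeff_pderiv)
  ultimately obtain z where z: "poly ?s z = 0" "v (z - 1) > 0"
    using hensel_scaled[of u ?s 1] ge u0 least[of k] k by auto
  \<comment> \<open>In the original variable, \<open>z\<close> close to 1 is a root of a derivative
    of \<open>p\<close> that is closer to \<open>b + t\<close> than \<open>b\<close> is.\<close>
  have root: "poly ((pderiv ^^ k) p) (b + t * z) = 0"
    using z(1) t unfolding q_def higher_pderiv_pcompose_linear
    by (simp add: poly_pcompose mult.commute)
  moreover have "(pderiv ^^ k) p \<noteq> 0"
    using deriv_le u0 unfolding q_def higher_pderiv_pcompose_linear by auto
  ultimately have "v (b + t - (b + t * z)) \<le> v t" using closest by blast
  moreover have "b + t - (b + t * z) = t * (1 - z)" by (simp add: algebra_simps)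
  moreover have "v (t * 1) < v (t * (1 - z))"
    using z(2) t v_cancel_less[of t 1 "1 - z"] by (simp add: v_diff_commute)
  ultimately show False by simp
qed

lemma sim_coeff_taylor:
  assumes "sim (poly ((pderiv ^^ j) p) b) (poly ((pderiv ^^ j) p') b')" and "sim t t'"
  shows "sim (coeff (p \<circ>\<^sub>p [:b, t:]) j) (coeff (p' \<circ>\<^sub>p [:b', t':]) j)"
  unfolding coeff_taylor divide_inverse using assms
  by (intro sim_mult sim_power) auto

text \<open>Closeness is required on the side of \<open>p\<close> alone; similarity of all Taylor
  terms carries the result to \<open>p'\<close>.\<close>

lemma sim_poly_shift:
  assumes t: "t \<noteq> 0"
    and closest: "\<And>m z. (pderiv ^^ m) p \<noteq> 0 \<Longrightarrow> poly ((pderiv ^^ m) p) z = 0 \<Longrightarrow>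
      v (b + t - z) \<le> v t"
    and "\<And>j. sim (poly ((pderiv ^^ j) p) b) (poly ((pderiv ^^ j) p') b')" and "sim t t'"
  shows "sim (poly p (b + t)) (poly p' (b' + t'))"
  using sim_poly_1[of "p \<circ>\<^sub>p [:b, t:]" "p' \<circ>\<^sub>p [:b', t':]"]
    no_cancellation_at_closest_root[OF t closest] sim_coeff_taylor assms(3,4)
  by (simp add: poly_pcompose)

text \<open>Absence of cancellation in \<open>pderiv p\<close> bounds all coefficients of
  \<open>q\<close> from degree 1 on by \<open>u\<close>, the derivative of \<open>q\<close> at 1; as
  \<open>q\<close> vanishes at 1, the constant coefficient obeys the same bound. Similar
  coefficients then give \<open>q'\<close> a value above \<open>v u\<close> at 1 and a derivative of
  value \<open>v u\<close>, so Hensel's lemma yields a root near 1. The roots of \<open>p\<close>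
  itself are exempt from \<open>closest\<close>, since \<open>b + t\<close> is one of them.\<close>

lemma simple_root_transfer:
  assumes t: "t \<noteq> 0" and root: "poly p (b + t) = 0" and dp: "poly (pderiv p) (b + t) \<noteq> 0"
    and closest: "\<And>m z. (pderiv ^^ Suc m) p \<noteq> 0 \<Longrightarrow> poly ((pderiv ^^ Suc m) p) z = 0 \<Longrightarrow>
      v (b + t - z) \<le> v t"
    and sim: "\<And>j. sim (poly ((pderiv ^^ j) p) b) (poly ((pderiv ^^ j) p') b')"
  shows "\<exists>t'. sim t t' \<and> poly p' (b' + t') = 0"
proof -
  define q where "q = p \<circ>\<^sub>p [:b, t:]"
  define q' where "q' = p' \<circ>\<^sub>p [:b', t:]"
  define u where "u = poly (pderiv q) 1"
  have pderiv_q: "pderiv q = smult t (pderiv p \<circ>\<^sub>p [:b, t:])"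
    by (simp add: q_def pderiv_pcompose pderiv_pCons)
  have u0: "u \<noteq> 0" unfolding u_def pderiv_q using t dp by (simp add: poly_pcompose)
  have Suc_ge: "v u \<le> v (coeff q (Suc j))" for j
  proof -
    have "v (poly (pderiv p) (b + t)) \<le> v (coeff (pderiv p \<circ>\<^sub>p [:b, t:]) j)"
      using closest by (intro no_cancellation_at_closest_root[OF t]) (auto simp: funpow_swap1)
    then have "v u \<le> v (coeff (pderiv q) j)"
      unfolding u_def pderiv_q by (simp add: poly_pcompose v_mult add_left_mono)
    then show ?thesis by (simp add: v_coeff_pderiv)
  qed
  have "v u \<le> v (coeff q 0)"
  proof -
    obtain a r where ar: "q = pCons a r" by (cases q)
    have "a = - poly r 1" using root ar unfolding q_def
      by (metis poly_pcompose poly_pCons add_eq_0_iff2 mult_1 mult_1_right poly_0 add.right_neutral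
          mult.commute mult_zero_right)
    moreover have "v u \<le> v (poly r 1)" using Suc_ge by (intro v_poly_ge) (auto simp: ar)
    ultimately show ?thesis by (simp add: ar)
  qed
  then have ge: "v u \<le> v (coeff q j)" for j using Suc_ge by (cases j) auto
  have sim_q: "sim (coeff q j) (coeff q' j)" for j
    unfolding q_def q'_def using sim by (intro sim_coeff_taylor) auto
  have ge': "v u \<le> v (coeff q' j)" for j using ge[of j] sim_v[OF sim_q] by simp
  have gt: "v u < v (coeff (q' - q) j)" for j
    using sim_q[of j] ge[of j] u0 by (auto simp: sim_def v_diff_commute)
  have "poly q 1 = 0" using root by (simp add: q_def poly_pcompose)
  then have "v u < v (poly q' 1)" using v_poly_gt[OF gt, of 1] by simp
  moreover have "v (poly (pderiv q') 1) = v u"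
  proof -
    have "v u < v (poly (pderiv (q' - q)) 1)"
      using gt by (intro v_poly_gt) (auto simp: v_coeff_pderiv)
    then show ?thesis
      using v_eq_if_close[of u "poly (pderiv q') 1"]
      by (simp add: u_def pderiv_diff v_diff_commute)
  qed
  ultimately obtain z where z: "poly q' z = 0" "v (z - 1) > 0"
    using hensel_scaled[of u q' 1] ge' u0 by auto
  have "v (t * 1) < v (t * (1 - z))"
    using z(2) t v_cancel_less[of t 1 "1 - z"] by (simp add: v_diff_commute)
  then have "sim t (t * z)" by (simp add: sim_def algebra_simps)
  moreover have "poly p' (b' + t * z) = 0"
    using z(1) by (simp add: q'_def poly_pcompose mult.commute)
  ultimately show ?thesis by blast
qed

end

section \<open>Families of polynomials\<close>

text \<open>The abstract ring \<open>\<F>\<close> of coefficient functions will be the functions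
  given by field terms whose value does not depend on one chosen variable; polynomials over it are
  polynomials in that variable.\<close>

locale poly_families = henselian_valuation v
  for v :: "'k::field_char_0 \<Rightarrow> ereal" +
  fixes \<F> :: "('x \<Rightarrow> 'k) set"
  assumes F_0: "(\<lambda>_. 0) \<in> \<F>" and F_1: "(\<lambda>_. 1) \<in> \<F>"
    and F_add: "a \<in> \<F> \<Longrightarrow> b \<in> \<F> \<Longrightarrow> (\<lambda>x. a x + b x) \<in> \<F>"
    and F_uminus: "a \<in> \<F> \<Longrightarrow> (\<lambda>x. - a x) \<in> \<F>"
    and F_mult: "a \<in> \<F> \<Longrightarrow> b \<in> \<F> \<Longrightarrow> (\<lambda>x. a x * b x) \<in> \<F>"
begin

lemma F_diff: "a \<in> \<F> \<Longrightarrow> b \<in> \<F> \<Longrightarrow> (\<lambda>x. a x - b x) \<in> \<F>"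
  using F_add[of a "\<lambda>x. - b x"] F_uminus[of b] by simp

lemma F_of_nat: "(\<lambda>_. of_nat n) \<in> \<F>"
  by (induction n) (auto intro: F_0 F_add F_1)

lemma F_sum: "(\<And>i. i \<in> I \<Longrightarrow> a i \<in> \<F>) \<Longrightarrow> (\<lambda>x. \<Sum>i\<in>I. a i x) \<in> \<F>"
  by (induction I rule: infinite_finite_induct) (auto intro: F_0 F_add)

text \<open>\<open>d\<close> bounds the number of coefficients uniformly in \<open>x\<close>, so
  \<open>PF 0\<close> holds only the zero family. The top coefficient may vanish at some
  \<open>x\<close>, and such points need separate treatment.\<close>

definition PF :: "nat \<Rightarrow> ('x \<Rightarrow> 'k poly) set" where
  "PF d = {p. (\<forall>i. (\<lambda>x. coeff (p x) i) \<in> \<F>) \<and> (\<forall>x i. i \<ge> d \<longrightarrow> coeff (p x) i = 0)}"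

lemma PF_coeff: "p \<in> PF d \<Longrightarrow> (\<lambda>x. coeff (p x) i) \<in> \<F>"
  by (simp add: PF_def)

lemma PF_coeff_0: "p \<in> PF d \<Longrightarrow> i \<ge> d \<Longrightarrow> coeff (p x) i = 0"
  by (simp add: PF_def)

lemma PF_mono: "d \<le> d' \<Longrightarrow> PF d \<subseteq> PF d'"
  by (auto simp: PF_def)

lemma PF_0: "(\<lambda>_. 0) \<in> PF d"
  by (simp add: PF_def F_0)

lemma PF_const: "a \<in> \<F> \<Longrightarrow> (\<lambda>x. [:a x:]) \<in> PF (Suc d)"
proof -
  assume "a \<in> \<F>"
  then have "(\<lambda>x. coeff [:a x:] i) \<in> \<F>" for i using F_0 by (cases i) auto
  then show ?thesis by (auto simp: PF_def coeff_pCons split: nat.split)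
qed

lemma PF_add: "p \<in> PF d \<Longrightarrow> q \<in> PF d \<Longrightarrow> (\<lambda>x. p x + q x) \<in> PF d"
  by (auto simp: PF_def intro: F_add)

lemma PF_uminus: "p \<in> PF d \<Longrightarrow> (\<lambda>x. - p x) \<in> PF d"
  by (auto simp: PF_def intro: F_uminus)

lemma PF_mult:
  assumes p: "p \<in> PF d" and q: "q \<in> PF d'"
  shows "(\<lambda>x. p x * q x) \<in> PF (d + d')"
proof -
  have "(\<lambda>x. coeff (p x * q x) i) \<in> \<F>" for i
    unfolding coeff_mult using assms by (intro F_sum F_mult PF_coeff)
  moreover have "coeff (p x * q x) i = 0" if "i \<ge> d + d'" for x i
    unfolding coeff_mult
  proof (intro sum.neutral ballI)
    fix k assume "k \<in> {..i}"
    then have "k \<ge> d \<or> i - k \<ge> d'" using that by auto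
    then show "coeff (p x) k * coeff (q x) (i - k) = 0"
      using p q PF_coeff_0 by fastforce
  qed
  ultimately show ?thesis by (simp add: PF_def)
qed

lemma PF_pderiv: "p \<in> PF (Suc d) \<Longrightarrow> (\<lambda>x. pderiv (p x)) \<in> PF d"
  using F_mult[OF F_of_nat] by (auto simp: PF_def coeff_pderiv simp del: of_nat_Suc)

lemma PF_higher_pderiv: "p \<in> PF d \<Longrightarrow> (\<lambda>x. (pderiv ^^ j) (p x)) \<in> PF d"
proof (induction j)
  case (Suc j)
  then have "(\<lambda>x. (pderiv ^^ j) (p x)) \<in> PF (Suc d)" using PF_mono[of d "Suc d"] by auto
  from PF_pderiv[OF this] show ?case by simp
qed simp

lemma PF_higher_pderiv_0: "p \<in> PF d \<Longrightarrow> j \<ge> d \<Longrightarrow> (pderiv ^^ j) (p x) = 0"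
proof (rule poly_eqI)
  fix i assume "p \<in> PF d" "j \<ge> d"
  then have "coeff (p x) (i + j) = 0" using PF_coeff_0[of p d] by simp
  then show "coeff ((pderiv ^^ j) (p x)) i = coeff 0 i"
    by (simp add: coeff_higher_pderiv add.commute)
qed

definition derivs :: "('x \<Rightarrow> 'k poly) set \<Rightarrow> ('x \<Rightarrow> 'k poly) set" where
  "derivs G = {\<lambda>x. (pderiv ^^ j) (g x) | g j. g \<in> G}"

lemma subset_derivs: "G \<subseteq> derivs G"
proof
  fix g assume "g \<in> G"
  then show "g \<in> derivs G"
    unfolding derivs_def by (intro CollectI exI[of _ g] exI[of _ 0]) simp
qed

lemma derivs_PF: "G \<subseteq> PF d \<Longrightarrow> derivs G \<subseteq> PF d"
  by (auto simp: derivs_def PF_higher_pderiv)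

lemma derivs_closed: "g \<in> derivs G \<Longrightarrow> (\<lambda>x. (pderiv ^^ j) (g x)) \<in> derivs G"
proof -
  assume "g \<in> derivs G"
  then obtain g' i where g': "g' \<in> G" "g = (\<lambda>x. (pderiv ^^ i) (g' x))"
    by (auto simp: derivs_def)
  then have "(\<lambda>x. (pderiv ^^ j) (g x)) = (\<lambda>x. (pderiv ^^ (j + i)) (g' x))"
    by (simp add: funpow_add)
  then show ?thesis using g' by (auto simp: derivs_def)
qed

lemma finite_derivs:
  assumes "finite G" and G: "G \<subseteq> PF d"
  shows "finite (derivs G)"
proof -
  have "derivs G \<subseteq> insert (\<lambda>_. 0) ((\<lambda>(g, j) x. (pderiv ^^ j) (g x)) ` (G \<times> {..<d}))"
  proof
    fix h assume "h \<in> derivs G"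
    then obtain g j where g: "g \<in> G" "h = (\<lambda>x. (pderiv ^^ j) (g x))"
      by (auto simp: derivs_def)
    show "h \<in> insert (\<lambda>_. 0) ((\<lambda>(g, j) x. (pderiv ^^ j) (g x)) ` (G \<times> {..<d}))"
    proof (cases "j < d")
      case True
      then show ?thesis using g by force
    next
      case False
      have "(pderiv ^^ j) (g x) = 0" for x
        using G g False by (intro PF_higher_pderiv_0[of g d]) auto
      then show ?thesis using g by simp
    qed
  qed
  then show ?thesis using assms(1) finite_subset by blast
qed

text \<open>Top coefficients of \<open>g\<close> are cancelled one by one against \<open>h\<close>;
  multiplying by the top coefficient of \<open>h\<close> instead of dividing keeps all coefficients
  in \<open>\<F>\<close>. At roots of \<open>h\<close> the subtracted multiples disappear, so no
  quotient has to be recorded.\<close>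

lemma pseudo_remainder:
  assumes h: "h \<in> PF (Suc k)" and g: "g \<in> PF m"
  shows "\<exists>r\<in>PF k. \<exists>N. \<forall>x y. poly (h x) y = 0 \<longrightarrow>
    coeff (h x) k ^ N * poly (g x) y = poly (r x) y"
  using g
proof (induction m arbitrary: g)
  case 0
  then show ?case using PF_mono[of 0 k] by (intro bexI[of _ g] exI[of _ 0]) auto
next
  case (Suc m)
  show ?case
  proof (cases "Suc m \<le> k")
    case True
    then show ?thesis
      using Suc.prems PF_mono[OF True] by (intro bexI[of _ g] exI[of _ 0]) auto
  next
    case False
    define g' where "g' x = smult (coeff (h x) k) (g x) -
      smult (coeff (g x) m) (monom 1 (m - k) * h x)" for x
    have "g' \<in> PF m"
    proof -
      have coeff_g': "coeff (g' x) i = coeff (h x) k * coeff (g x) i -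
        coeff (g x) m * (if i < m - k then 0 else coeff (h x) (i - (m - k)))" for x i
        by (simp add: g'_def coeff_monom_mult)
      have "(\<lambda>x. coeff (g' x) i) \<in> \<F>" for i
        unfolding coeff_g' using h Suc.prems F_0
        by (cases "i < m - k") (auto intro!: F_diff F_mult PF_coeff)
      moreover have "coeff (g' x) i = 0" if "i \<ge> m" for x i
      proof (cases "i = m")
        case True
        then show ?thesis using False by (simp add: coeff_g' mult.commute)
      next
        case False
        then show ?thesis
          using that \<open>\<not> Suc m \<le> k\<close> PF_coeff_0[OF h, of "i - (m - k)"] PF_coeff_0[OF Suc.prems, of i]
          by (simp add: coeff_g')
      qed
      ultimately show ?thesis by (simp add: PF_def)
    qed
    then obtain r N where r: "r \<in> PF k" and
      eq: "\<And>x y. poly (h x) y = 0 \<Longrightarrow> coeff (h x) k ^ N * poly (g' x) y = poly (r x) y"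
      using Suc.IH by blast
    have "coeff (h x) k ^ Suc N * poly (g x) y = poly (r x) y" if "poly (h x) y = 0" for x y
      using eq[OF that] that by (simp add: g'_def algebra_simps)
    then show ?thesis using r by blast
  qed
qed

text \<open>The finite set of lower degree families to which the induction on the degree is passed on:
  remainders, truncations and derivatives.\<close>

lemma degree_reduction:
  assumes G: "finite G" "G \<subseteq> PF D"
  shows "\<exists>G1. finite G1 \<and> G1 \<subseteq> PF (Suc d) \<and>
    (\<forall>g\<in>G1. \<forall>j. (\<lambda>x. (pderiv ^^ j) (g x)) \<in> G1) \<and>
    (\<forall>h\<in>G \<inter> PF (Suc (Suc d)). (\<lambda>x. pderiv (h x)) \<in> G1 \<and>
      (\<exists>r\<in>G1. \<forall>x. coeff (h x) (Suc d) = 0 \<longrightarrow> r x = h x) \<and>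
      (\<forall>g\<in>G. \<exists>r\<in>G1. \<exists>N. \<forall>x y. poly (h x) y = 0 \<longrightarrow>
        coeff (h x) (Suc d) ^ N * poly (g x) y = poly (r x) y))"
proof -
  define Gd where "Gd = G \<inter> PF (Suc (Suc d))"
  have "\<forall>h\<in>Gd. \<forall>g\<in>G. \<exists>r. r \<in> PF (Suc d) \<and> (\<exists>N. \<forall>x y. poly (h x) y = 0 \<longrightarrow>
      coeff (h x) (Suc d) ^ N * poly (g x) y = poly (r x) y)"
    using pseudo_remainder[of _ "Suc d" _ D] G(2) unfolding Gd_def by blast
  then obtain rem where rem: "\<And>h g. h \<in> Gd \<Longrightarrow> g \<in> G \<Longrightarrow> rem h g \<in> PF (Suc d)"
    and rem_eq: "\<And>h g. h \<in> Gd \<Longrightarrow> g \<in> G \<Longrightarrow> \<exists>N. \<forall>x y. poly (h x) y = 0 \<longrightarrow>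
      coeff (h x) (Suc d) ^ N * poly (g x) y = poly (rem h g x) y"
    by metis
  \<comment> \<open>Where the top coefficient of \<open>h\<close> vanishes the pseudo-division says
    nothing; there the truncation replaces \<open>h\<close> by a family of lower formal
    degree.\<close>
  define trunc where "trunc h x = h x - monom (coeff (h x) (Suc d)) (Suc d)"
    for h :: "'x \<Rightarrow> 'k poly" and x
  have trunc: "trunc h \<in> PF (Suc d)" if "h \<in> Gd" for h
  proof -
    have h: "h \<in> PF (Suc (Suc d))" using that by (simp add: Gd_def)
    have "(\<lambda>x. coeff (trunc h x) i) \<in> \<F>" for i
      using PF_coeff[OF h] F_0 by (cases "i = Suc d") (auto simp: trunc_def)
    moreover have "coeff (trunc h x) i = 0" if "i \<ge> Suc d" for x i
      using that PF_coeff_0[OF h, of i] by (cases "i = Suc d") (auto simp: trunc_def)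
    ultimately show ?thesis by (simp add: PF_def)
  qed
  define G0 where "G0 = (\<Union>h\<in>Gd. rem h ` G) \<union> trunc ` Gd \<union> (\<lambda>h x. pderiv (h x)) ` Gd"
  have G0: "finite G0" "G0 \<subseteq> PF (Suc d)"
  proof -
    have "finite Gd" using G unfolding Gd_def by simp
    then show "finite G0" using G unfolding G0_def by simp
    have "(\<lambda>h x. pderiv (h x)) ` Gd \<subseteq> PF (Suc d)"
      using PF_pderiv[of _ "Suc d"] unfolding Gd_def by blast
    then show "G0 \<subseteq> PF (Suc d)" using rem trunc unfolding G0_def by blast
  qed
  show ?thesis
  proof (intro exI[of _ "derivs G0"] conjI ballI allI)
    show "finite (derivs G0)" "derivs G0 \<subseteq> PF (Suc d)"
      using G0 finite_derivs derivs_PF by auto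
    show "\<And>g j. g \<in> derivs G0 \<Longrightarrow> (\<lambda>x. (pderiv ^^ j) (g x)) \<in> derivs G0"
      by (rule derivs_closed)
    fix h assume "h \<in> G \<inter> PF (Suc (Suc d))"
    then have h: "h \<in> Gd" by (simp add: Gd_def)
    then show "(\<lambda>x. pderiv (h x)) \<in> derivs G0"
      using subset_derivs[of G0] by (auto simp: G0_def)
    have "trunc h \<in> derivs G0"
      using h subset_derivs[of G0] by (auto simp: G0_def)
    then show "\<exists>r\<in>derivs G0. \<forall>x. coeff (h x) (Suc d) = 0 \<longrightarrow> r x = h x"
      by (intro bexI[of _ "trunc h"]) (auto simp: trunc_def)
    fix g assume g: "g \<in> G"
    have "rem h g \<in> derivs G0"
      using h g subset_derivs[of G0] by (auto simp: G0_def)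
    then show "\<exists>r\<in>derivs G0. \<exists>N. \<forall>x y. poly (h x) y = 0 \<longrightarrow>
      coeff (h x) (Suc d) ^ N * poly (g x) y = poly (r x) y"
      using rem_eq[OF h g] by blast
  qed
qed

section \<open>Transfer of points between fibres\<close>

text \<open>Members that are the zero polynomial at \<open>x\<close> are left out, which keeps the
  set finite.\<close>

definition roots :: "('x \<Rightarrow> 'k poly) set \<Rightarrow> 'x \<Rightarrow> 'k set" where
  "roots G x = {z. \<exists>g\<in>G. g x \<noteq> 0 \<and> poly (g x) z = 0}"

lemma rootsI: "g \<in> G \<Longrightarrow> g x \<noteq> 0 \<Longrightarrow> poly (g x) z = 0 \<Longrightarrow> z \<in> roots G x"
  by (auto simp: roots_def)

lemma finite_roots: "finite G \<Longrightarrow> finite (roots G x)"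
proof -
  assume "finite G"
  then have "finite (\<Union>g\<in>{g \<in> G. g x \<noteq> 0}. {z. poly (g x) z = 0})"
    using poly_roots_finite by auto
  moreover have "roots G x = (\<Union>g\<in>{g \<in> G. g x \<noteq> 0}. {z. poly (g x) z = 0})"
    by (auto simp: roots_def)
  ultimately show ?thesis by simp
qed

text \<open>The point 0 is added to have a center even without roots; the values of the family there
  are its constant coefficients, which lie in \<open>\<F>\<close>.\<close>

lemma closest_center:
  assumes "finite G"
  obtains b where "b \<in> insert 0 (roots G x)" "\<And>z. z \<in> insert 0 (roots G x) \<Longrightarrow> v (c - z) \<le> v (c - b)"
proof -
  let ?S = "insert 0 (roots G x)"
  have fin: "finite ((\<lambda>z. v (c - z)) ` ?S)" using finite_roots[OF assms] by simp
  then have "Max ((\<lambda>z. v (c - z)) ` ?S) \<in> (\<lambda>z. v (c - z)) ` ?S" by (intro Max_in) auto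
  then obtain b where b: "b \<in> ?S" "Max ((\<lambda>z. v (c - z)) ` ?S) = v (c - b)"
    by (elim imageE)
  have "v (c - z) \<le> v (c - b)" if "z \<in> ?S" for z
    unfolding b(2)[symmetric] using fin that by (intro Max_ge) auto
  with b(1) show thesis by (rule that)
qed

text \<open>Closure under derivatives is used twice: the roots of derivatives compete as centers,
  and the values of derivatives at \<open>b\<close> supply the Taylor terms.\<close>

lemma sim_at_closest_center:
  assumes closed: "\<And>g j. g \<in> G \<Longrightarrow> (\<lambda>x. (pderiv ^^ j) (g x)) \<in> G"
    and closest: "\<And>z. z \<in> insert 0 (roots G x) \<Longrightarrow> v (c - z) \<le> v (c - b)" and "c \<noteq> b"
    and sim: "\<And>g. g \<in> G \<Longrightarrow> sim (poly (g x) b) (poly (g x') b')" and t: "sim (c - b) t" and g: "g \<in> G"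
  shows "sim (poly (g x) c) (poly (g x') (b' + t))"
proof -
  have "sim (poly (g x) (b + (c - b))) (poly (g x') (b' + t))"
  proof (rule sim_poly_shift)
    fix m z assume "(pderiv ^^ m) (g x) \<noteq> 0" "poly ((pderiv ^^ m) (g x)) z = 0"
    then have "z \<in> roots G x" using closed[OF g, of m] by (auto simp: roots_def)
    then show "v (b + (c - b) - z) \<le> v (c - b)" using closest by simp
  qed (use assms sim[OF closed[OF g]] in auto)
  then show ?thesis by simp
qed

lemma PF_const_root:
  assumes "h \<in> PF (Suc 0)" "poly (h x) c = 0"
  shows "h x = 0"
proof -
  have "h x = [:coeff (h x) 0:]"
    using PF_coeff_0[OF assms(1)] by (intro poly_eqI) (auto simp: coeff_pCons split: nat.split)
  then show ?thesis using assms(2) by (metis poly_pCons poly_0 mult_zero_right add_0_right pCons_0_0)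
qed

text \<open>One companion \<open>c'\<close> has to serve all of \<open>G\<close> at once. By
  induction on the formal degree the closest center \<open>b\<close>, a root of lower degree or 0,
  has a companion \<open>b'\<close>. If \<open>c\<close> differs from \<open>b\<close>, then it is a
  simple root of \<open>h\<close> and moves by Hensel's lemma to \<open>b' + t\<close>; the other
  members are compared through their pseudo-remainders, which have lower degree.\<close>

lemma root_transfer:
  assumes "finite G" "G \<subseteq> PF D"
  shows "\<exists>H. finite H \<and> H \<subseteq> \<F> \<and> (\<forall>x x'. (\<forall>a\<in>H. sim (a x) (a x')) \<longrightarrow>
    (\<forall>h\<in>G \<inter> PF (Suc d). \<forall>c. h x \<noteq> 0 \<and> poly (h x) c = 0 \<longrightarrow>
      (\<exists>c'. \<forall>g\<in>G. sim (poly (g x) c) (poly (g x') c'))))"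
  using assms
proof (induction d arbitrary: G D)
  case 0
  show ?case using PF_const_root by (intro exI[of _ "{}"]) blast
next
  case (Suc d)
  obtain G1 where G1: "finite G1" "G1 \<subseteq> PF (Suc d)"
    and closed': "\<forall>g\<in>G1. \<forall>j. (\<lambda>x. (pderiv ^^ j) (g x)) \<in> G1"
    and reduction: "\<forall>h\<in>G \<inter> PF (Suc (Suc d)). (\<lambda>x. pderiv (h x)) \<in> G1 \<and>
      (\<exists>r\<in>G1. \<forall>x. coeff (h x) (Suc d) = 0 \<longrightarrow> r x = h x) \<and>
      (\<forall>g\<in>G. \<exists>r\<in>G1. \<exists>N. \<forall>x y. poly (h x) y = 0 \<longrightarrow>
        coeff (h x) (Suc d) ^ N * poly (g x) y = poly (r x) y)"
    using degree_reduction[OF Suc.prems, of d] by (elim exE conjE)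
  note closed = closed'[rule_format]
  \<comment> \<open>The companion of the center must respect the derivatives of \<open>h\<close>,
    which are its Taylor coefficients there, as well as the remainders in \<open>G1\<close>.\<close>
  define G2 where "G2 = derivs G \<union> G1"
  have G2: "finite G2" "G2 \<subseteq> PF (D + Suc d)"
    using finite_derivs[OF Suc.prems] derivs_PF[OF Suc.prems(2)] G1
      PF_mono[of D "D + Suc d"] PF_mono[of "Suc d" "D + Suc d"] unfolding G2_def by auto
  have G_G2: "G \<subseteq> G2" using subset_derivs unfolding G2_def by blast
  obtain H where H: "finite H" "H \<subseteq> \<F>" and H_root: "\<forall>x x'. (\<forall>a\<in>H. sim (a x) (a x')) \<longrightarrow>
      (\<forall>h\<in>G2 \<inter> PF (Suc d). \<forall>c. h x \<noteq> 0 \<and> poly (h x) c = 0 \<longrightarrow>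
        (\<exists>c'. \<forall>g\<in>G2. sim (poly (g x) c) (poly (g x') c')))"
    using Suc.IH[OF G2] by (elim exE conjE)
  \<comment> \<open>Constant coefficients settle the center 0; the coefficients of index
    \<open>Suc d\<close> make the leading factors in the pseudo-division similar.\<close>
  define H' where "H' = H \<union> (\<lambda>g x. coeff (g x) 0) ` G2 \<union> (\<lambda>g x. coeff (g x) (Suc d)) ` G2"
  have "finite H'" "H' \<subseteq> \<F>"
    using H G2 PF_coeff[of _ "D + Suc d"] unfolding H'_def by auto
  moreover have "\<exists>c'. \<forall>g\<in>G. sim (poly (g x) c) (poly (g x') c')"
    if x: "\<forall>a\<in>H'. sim (a x) (a x')" and h: "h \<in> G \<inter> PF (Suc (Suc d))"
      and root: "h x \<noteq> 0" "poly (h x) c = 0" for x x' h c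
  proof -
    obtain b where b: "b \<in> insert 0 (roots G1 x)"
      and closest: "\<And>z. z \<in> insert 0 (roots G1 x) \<Longrightarrow> v (c - z) \<le> v (c - b)"
      using closest_center[OF G1(1)] by blast
    obtain b' where b': "\<And>g. g \<in> G2 \<Longrightarrow> sim (poly (g x) b) (poly (g x') b')"
    proof (cases "b \<in> roots G1 x")
      case True
      then obtain k where k: "k \<in> G1" "k x \<noteq> 0 \<and> poly (k x) b = 0" by (auto simp: roots_def)
      then have "k \<in> G2 \<inter> PF (Suc d)" using G1 unfolding G2_def by blast
      moreover have "\<forall>a\<in>H. sim (a x) (a x')" using x unfolding H'_def by blast
      ultimately have "\<exists>c'. \<forall>g\<in>G2. sim (poly (g x) b) (poly (g x') c')"
        using H_root[rule_format, of x x' k b] k(2) by blast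
      then show thesis using that by blast
    next
      case False
      then have "b = 0" using b by blast
      have "sim (poly (g x) 0) (poly (g x') 0)" if "g \<in> G2" for g
        using x that unfolding H'_def by (simp add: ball_Un poly_0_coeff_0)
      then show thesis using that \<open>b = 0\<close> by blast
    qed
    have deriv: "(\<lambda>x. pderiv (h x)) \<in> G1"
      and trunc: "\<exists>r\<in>G1. \<forall>x. coeff (h x) (Suc d) = 0 \<longrightarrow> r x = h x"
      and rem: "\<forall>g\<in>G. \<exists>r\<in>G1. \<exists>N. \<forall>x y. poly (h x) y = 0 \<longrightarrow>
        coeff (h x) (Suc d) ^ N * poly (g x) y = poly (r x) y"
      using bspec[OF reduction h] by simp_all
    show ?thesis
    proof (cases "c = b")
      case True
      then show ?thesis using b' G_G2 by blast
    next
      case False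
      \<comment> \<open>A root would be its own closest center. So no lower-degree member that is
        nonzero at \<open>x\<close> vanishes at \<open>c\<close>, which makes the top coefficient of
        \<open>h\<close> nonzero and the root simple.\<close>
      have not_root: "c \<notin> roots G1 x"
        using closest[of c] False by auto
      let ?lc = "\<lambda>x. coeff (h x) (Suc d)"
      have lc: "?lc x \<noteq> 0"
        using trunc root not_root unfolding roots_def by fastforce
      have sim_lc: "sim (?lc x) (?lc x')"
        using x h G_G2 unfolding H'_def by (auto simp: ball_Un)
      have pderiv_nz: "pderiv (h x) \<noteq> 0"
      proof
        assume "pderiv (h x) = 0"
        then have "coeff (pderiv (h x)) d = 0" by simp
        then show False using lc by (simp add: coeff_pderiv del: of_nat_Suc)
      qed
      have higher_in: "(\<lambda>x. (pderiv ^^ Suc m) (h x)) \<in> G1" for m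
        using closed[OF deriv, of m] by (simp add: funpow_swap1)
      have "\<exists>t. sim (c - b) t \<and> poly (h x') (b' + t) = 0"
      proof (rule simple_root_transfer[of "c - b" "h x" b])
        show "poly (pderiv (h x)) (b + (c - b)) \<noteq> 0"
          using not_root deriv pderiv_nz by (auto simp: roots_def)
        fix m z assume "(pderiv ^^ Suc m) (h x) \<noteq> 0" "poly ((pderiv ^^ Suc m) (h x)) z = 0"
        then have "z \<in> roots G1 x" by (rule rootsI[OF higher_in])
        then show "v (b + (c - b) - z) \<le> v (c - b)" using closest by simp
      next
        fix j
        have "(\<lambda>x. (pderiv ^^ j) (h x)) \<in> G2"
          using derivs_closed[of h G j] h subset_derivs[of G] unfolding G2_def by blast
        from b'[OF this] show "sim (poly ((pderiv ^^ j) (h x)) b) (poly ((pderiv ^^ j) (h x')) b')" .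
      qed (use False root in auto)
      then obtain t where t: "sim (c - b) t" "poly (h x') (b' + t) = 0" by blast
      have "sim (poly (g x) c) (poly (g x') (b' + t))" if g: "g \<in> G" for g
      proof -
        obtain r N where r: "r \<in> G1" "\<And>x y. poly (h x) y = 0 \<Longrightarrow> ?lc x ^ N * poly (g x) y = poly (r x) y"
          using bspec[OF rem g] by blast
        have "sim (poly (k x) b) (poly (k x') b')" if "k \<in> G1" for k
          using b' that unfolding G2_def by blast
        then have "sim (poly (r x) c) (poly (r x') (b' + t))"
          by (intro sim_at_closest_center[where G = G1, OF closed closest False _ t(1) r(1)])
        \<comment> \<open>At both roots \<open>g\<close> equals its remainder up to a power of the
          leading coefficient; similar nonzero powers can be cancelled.\<close>
        then show ?thesis
          using sim_cancel[OF sim_power[OF sim_lc, of N]] lc r(2)[OF root(2)] r(2)[OF t(2)] by simp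
      qed
      then show ?thesis by blast
    qed
  qed
  ultimately show ?case by (intro exI[of _ H'] conjI allI impI ballI) simp_all
qed

text \<open>An arbitrary point is its closest center plus a displacement. The center moves by
  \<open>root_transfer\<close>, and the displacement is copied unchanged.\<close>

theorem point_transfer:
  assumes "finite G" "G \<subseteq> PF D"
  shows "\<exists>H. finite H \<and> H \<subseteq> \<F> \<and> (\<forall>x x'. (\<forall>a\<in>H. sim (a x) (a x')) \<longrightarrow>
    (\<forall>c. \<exists>c'. \<forall>g\<in>G. sim (poly (g x) c) (poly (g x') c')))"
proof -
  let ?G = "derivs G"
  have G: "finite ?G" "?G \<subseteq> PF (Suc D)"
    using finite_derivs[OF assms] derivs_PF[OF assms(2)] PF_mono[of D "Suc D"] by auto
  obtain H where H: "finite H" "H \<subseteq> \<F>" and H_root: "\<forall>x x'. (\<forall>a\<in>H. sim (a x) (a x')) \<longrightarrow>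
      (\<forall>h\<in>?G \<inter> PF (Suc D). \<forall>c. h x \<noteq> 0 \<and> poly (h x) c = 0 \<longrightarrow>
        (\<exists>c'. \<forall>g\<in>?G. sim (poly (g x) c) (poly (g x') c')))"
    using root_transfer[OF G, of D] by (elim exE conjE)
  define H' where "H' = H \<union> (\<lambda>g x. coeff (g x) 0) ` ?G"
  have "finite H'" "H' \<subseteq> \<F>"
    using H G PF_coeff[of _ "Suc D"] unfolding H'_def by auto
  moreover have "\<exists>c'. \<forall>g\<in>G. sim (poly (g x) c) (poly (g x') c')"
    if x: "\<forall>a\<in>H'. sim (a x) (a x')" for x x' c
  proof -
    obtain b where b: "b \<in> insert 0 (roots ?G x)"
      and closest: "\<And>z. z \<in> insert 0 (roots ?G x) \<Longrightarrow> v (c - z) \<le> v (c - b)"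
      using closest_center[OF G(1)] by blast
    obtain b' where b': "\<And>g. g \<in> ?G \<Longrightarrow> sim (poly (g x) b) (poly (g x') b')"
    proof (cases "b \<in> roots ?G x")
      case True
      then obtain k where k: "k \<in> ?G" "k x \<noteq> 0 \<and> poly (k x) b = 0" by (auto simp: roots_def)
      then have "k \<in> ?G \<inter> PF (Suc D)" using G by blast
      moreover have "\<forall>a\<in>H. sim (a x) (a x')" using x unfolding H'_def by blast
      ultimately have "\<exists>c'. \<forall>g\<in>?G. sim (poly (g x) b) (poly (g x') c')"
        using H_root[rule_format, of x x' k b] k(2) by blast
      then show thesis using that by blast
    next
      case False
      then have "b = 0" using b by blast
      have "sim (poly (g x) 0) (poly (g x') 0)" if "g \<in> ?G" for g
        using x that unfolding H'_def by (simp add: ball_Un poly_0_coeff_0)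
      then show thesis using that \<open>b = 0\<close> by blast
    qed
    show ?thesis
    proof (cases "c = b")
      case True
      then show ?thesis using b' subset_derivs by blast
    next
      case False
      have "sim (poly (g x) c) (poly (g x') (b' + (c - b)))" if g: "g \<in> G" for g
        using g subset_derivs[of G]
        by (intro sim_at_closest_center[where G = ?G, OF derivs_closed closest False b' sim_refl]) auto
      then show ?thesis by blast
    qed
  qed
  ultimately show ?thesis by (intro exI[of _ H'] conjI allI impI) simp_all
qed

end

section \<open>Continuity of simple roots\<close>

context henselian_valuation
begin

definition vtends :: "('y \<Rightarrow> 'k) \<Rightarrow> 'k \<Rightarrow> 'y filter \<Rightarrow> bool" where
  "vtends f l F \<longleftrightarrow> (\<forall>\<gamma>::real. eventually (\<lambda>z. v (f z - l) > ereal \<gamma>) F)"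

definition vnhds :: "'k \<Rightarrow> 'k filter" where
  "vnhds c = (INF \<gamma>::real. principal {y. v (y - c) > ereal \<gamma>})"

lemma eventually_vnhds:
  "eventually P (vnhds c) \<longleftrightarrow> (\<exists>\<gamma>::real. \<forall>y. v (y - c) > ereal \<gamma> \<longrightarrow> P y)"
proof -
  have "\<exists>k\<in>UNIV. principal {y. ereal k < v (y - c)} \<le> principal {y. ereal i < v (y - c)} \<and>
     principal {y. ereal k < v (y - c)} \<le> principal {y. ereal j < v (y - c)}" for i j :: real
    by (rule bexI[of _ "max i j"])
      (auto simp flip: ereal_max elim!: order.strict_trans1[rotated])
  then show ?thesis
    unfolding vnhds_def by (subst eventually_INF_base) (auto simp: eventually_principal)
qed

lemma vtends_const: "vtends (\<lambda>_. l) l F"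
  by (simp add: vtends_def)

lemma vtends_vnhds: "vtends (\<lambda>y. y) c (vnhds c)"
  by (auto simp: vtends_def eventually_vnhds)

lemma vtends_add: "vtends f l F \<Longrightarrow> vtends g m F \<Longrightarrow> vtends (\<lambda>z. f z + g z) (l + m) F"
  unfolding vtends_def
proof (intro allI)
  fix \<gamma> :: real
  assume "\<forall>\<gamma>::real. eventually (\<lambda>z. v (f z - l) > ereal \<gamma>) F"
    "\<forall>\<gamma>::real. eventually (\<lambda>z. v (g z - m) > ereal \<gamma>) F"
  then have "eventually (\<lambda>z. v (f z - l) > ereal \<gamma> \<and> v (g z - m) > ereal \<gamma>) F"
    by (simp add: eventually_conj)
  then show "eventually (\<lambda>z. v (f z + g z - (l + m)) > ereal \<gamma>) F"
  proof (rule eventually_mono)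
    fix z assume "ereal \<gamma> < v (f z - l) \<and> ereal \<gamma> < v (g z - m)"
    then have "ereal \<gamma> < v ((f z - l) + (g z - m))" by (intro v_add_gt) auto
    then show "ereal \<gamma> < v (f z + g z - (l + m))" by (simp add: algebra_simps)
  qed
qed

lemma vtends_uminus: "vtends f l F \<Longrightarrow> vtends (\<lambda>z. - f z) (- l) F"
proof -
  have "v (- f z - - l) = v (f z - l)" for z
    using v_minus[of "f z - l"] by simp
  then show "vtends f l F \<Longrightarrow> vtends (\<lambda>z. - f z) (- l) F"
    by (simp add: vtends_def)
qed

lemma v_mult_large: "\<exists>\<delta>::real. \<forall>a. v a > ereal \<delta> \<longrightarrow> v (l * a) > ereal \<gamma>"
proof (cases "l = 0")
  case False
  then obtain r where r: "v l = ereal r" using v_finite by blast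
  have "v (l * a) > ereal \<gamma>" if "v a > ereal (\<gamma> - r)" for a
    using that r by (cases "v a") (auto simp: v_mult)
  then show ?thesis by blast
qed simp

lemma vtends_mult:
  assumes f: "vtends f l F" and g: "vtends g m F"
  shows "vtends (\<lambda>z. f z * g z) (l * m) F"
  unfolding vtends_def
proof
  fix \<gamma> :: real
  obtain \<delta>1 :: real where \<delta>1: "\<And>a. v a > ereal \<delta>1 \<Longrightarrow> v (l * a) > ereal \<gamma>"
    using v_mult_large by blast
  obtain \<delta>2 :: real where \<delta>2: "\<And>a. v a > ereal \<delta>2 \<Longrightarrow> v (m * a) > ereal \<gamma>"
    using v_mult_large by blast
  have "eventually (\<lambda>z. v (f z - l) > ereal \<gamma> \<and> v (f z - l) > ereal \<delta>2 \<and>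
      v (g z - m) > ereal 0 \<and> v (g z - m) > ereal \<delta>1) F"
    using f g unfolding vtends_def by (intro eventually_conj) auto
  then show "eventually (\<lambda>z. v (f z * g z - l * m) > ereal \<gamma>) F"
  proof (rule eventually_mono)
    fix z assume z: "v (f z - l) > ereal \<gamma> \<and> v (f z - l) > ereal \<delta>2 \<and>
      v (g z - m) > ereal 0 \<and> v (g z - m) > ereal \<delta>1"
    have "v ((f z - l) * (g z - m)) > ereal \<gamma>"
      using z by (intro v_mult_gt) (auto simp: zero_ereal_def less_imp_le)
    then have "ereal \<gamma> < v ((f z - l) * (g z - m) + l * (g z - m) + m * (f z - l))"
      using z \<delta>1 \<delta>2 by (intro v_add_gt) auto
    then show "ereal \<gamma> < v (f z * g z - l * m)" by (simp add: algebra_simps)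
  qed
qed

lemma vtends_power: "vtends f l F \<Longrightarrow> vtends (\<lambda>z. f z ^ n) (l ^ n) F"
  by (induction n) (simp_all add: vtends_const vtends_mult)

lemma vtends_sum:
  "(\<And>i. i \<in> I \<Longrightarrow> vtends (f i) (l i) F) \<Longrightarrow> vtends (\<lambda>z. \<Sum>i\<in>I. f i z) (\<Sum>i\<in>I. l i) F"
  by (induction I rule: infinite_finite_induct) (simp_all add: vtends_const vtends_add)

lemma vtends_fst: "vtends f l F \<Longrightarrow> vtends (\<lambda>z. f (fst z)) l (F \<times>\<^sub>F G)"
  unfolding vtends_def
  using filter_leD[OF filtermap_fst_prod_filter] by (fastforce simp: eventually_filtermap)

lemma vtends_snd: "vtends f l G \<Longrightarrow> vtends (\<lambda>z. f (snd z)) l (F \<times>\<^sub>F G)"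
  unfolding vtends_def
  using filter_leD[OF filtermap_snd_prod_filter] by (fastforce simp: eventually_filtermap)

lemma vtends_sim: "vtends f l F \<Longrightarrow> l \<noteq> 0 \<Longrightarrow> eventually (\<lambda>z. sim l (f z)) F"
proof -
  assume f: "vtends f l F" and "l \<noteq> 0"
  then obtain r where r: "v l = ereal r" using v_finite by blast
  have "eventually (\<lambda>z. v (f z - l) > ereal r) F" using f by (simp add: vtends_def)
  then show ?thesis
    by (rule eventually_mono) (simp add: sim_def r v_diff_commute[of l])
qed

end

context poly_families
begin

lemma PF_poly_altdef: "p \<in> PF d \<Longrightarrow> poly (p x) y = (\<Sum>i<d. coeff (p x) i * y ^ i)"
proof -
  assume p: "p \<in> PF d"
  have "poly (p x) y = (\<Sum>i\<le>max d (degree (p x)). coeff (p x) i * y ^ i)"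
    unfolding poly_altdef by (intro sum.mono_neutral_left) (auto simp: coeff_eq_0)
  also have "\<dots> = (\<Sum>i<d. coeff (p x) i * y ^ i)"
    using PF_coeff_0[OF p] by (intro sum.mono_neutral_right) auto
  finally show ?thesis .
qed

lemma vtends_poly:
  assumes g: "g \<in> PF D" and F: "\<forall>a\<in>\<F>. vtends a (a x0) F"
  shows "vtends (\<lambda>z. poly (g (fst z)) (snd z)) (poly (g x0) c) (F \<times>\<^sub>F vnhds c)"
  unfolding PF_poly_altdef[OF g]
proof (intro vtends_sum vtends_mult vtends_power)
  fix i
  have "vtends (\<lambda>x. coeff (g x) i) (coeff (g x0) i) F"
    using F PF_coeff[OF g] by fast
  then show "vtends (\<lambda>z. coeff (g (fst z)) i) (coeff (g x0) i) (F \<times>\<^sub>F vnhds c)"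
    by (rule vtends_fst)
  show "vtends snd c (F \<times>\<^sub>F vnhds c)"
    using vtends_snd[OF vtends_vnhds] .
qed

lemma vtends_poly_fixed:
  assumes g: "g \<in> PF D" and F: "\<forall>a\<in>\<F>. vtends a (a x0) F"
  shows "vtends (\<lambda>x. poly (g x) c) (poly (g x0) c) F"
  unfolding PF_poly_altdef[OF g]
proof (intro vtends_sum vtends_mult vtends_const)
  fix i
  show "vtends (\<lambda>x. coeff (g x) i) (coeff (g x0) i) F"
    using F PF_coeff[OF g] by fast
qed

text \<open>The rescaled polynomial \<open>q\<close>, that is \<open>h x\<close> at
  \<open>c + s * X\<close>, is dominated by its linear coefficient: the constant one tends to 0 as
  \<open>x\<close> approaches \<open>x0\<close>, and the higher ones carry an extra factor
  \<open>s\<close>. Hensel's lemma at 0 gives a root \<open>z\<close>, hence the root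
  \<open>c + s * z\<close> of \<open>h x\<close>.\<close>

lemma simple_root_near:
  assumes h: "h \<in> PF D" and F: "\<forall>a\<in>\<F>. vtends a (a x0) F"
    and root: "poly (h x0) c = 0" and simple: "poly (pderiv (h x0)) c \<noteq> 0"
  shows "eventually (\<lambda>x. \<exists>c'. poly (h x) c' = 0 \<and> v (c' - c) > ereal \<gamma>) F"
proof -
  define a where "a j x = poly ((pderiv ^^ j) (h x)) c / fact j" for j x
  have a_tends: "vtends (a j) (a j x0) F" for j
    using vtends_mult[OF vtends_poly_fixed[OF PF_higher_pderiv[OF h] F] vtends_const]
    unfolding a_def divide_inverse .
  have a_0: "a j x = 0" if "j \<ge> D" for j x
    using PF_higher_pderiv_0[OF h that] by (simp add: a_def)
  define \<alpha> where "\<alpha> = a 1 x0"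
  have \<alpha>: "\<alpha> \<noteq> 0" using simple by (simp add: \<alpha>_def a_def)
  then obtain r where r: "v \<alpha> = ereal r" using v_finite by blast
  have "vtends (\<lambda>s. a j x0 * s) 0 (vnhds 0)" for j
    using vtends_mult[OF vtends_const vtends_vnhds, of "a j x0" 0] by simp
  then have "eventually (\<lambda>s. \<forall>j\<in>{..D}. v (a j x0 * s) > ereal r) (vnhds 0)"
    unfolding vtends_def by (intro eventually_ball_finite) auto
  then obtain \<delta> :: real where \<delta>: "\<And>s j. v s > ereal \<delta> \<Longrightarrow> j \<le> D \<Longrightarrow> v (a j x0 * s) > ereal r"
    unfolding eventually_vnhds by auto
  \<comment> \<open>The bound \<open>\<delta>\<close> makes the higher coefficients at
    \<open>x0\<close> harmless, \<open>\<gamma>\<close> puts the root into the required ball, and 0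
    makes the powers of \<open>s\<close> integral.\<close>
  obtain s where s: "s \<noteq> 0" "v s > ereal (max \<delta> (max \<gamma> 0))" using exists_v_gt by blast
  have s_gt: "v s > ereal \<delta>" "v s > ereal \<gamma>" "v s > 0"
    using s(2) by (auto elim!: order.strict_trans1[rotated] simp: zero_ereal_def)
  define u where "u = \<alpha> * s"
  have u: "u \<noteq> 0" using \<alpha> s by (simp add: u_def)
  then obtain r' where r': "v u = ereal r'" using v_finite by blast
  \<comment> \<open>The constant coefficient must fall below \<open>\<alpha> * s\<close>, hence the
    finer bound \<open>r'\<close>. The range up to \<open>Suc D\<close> contains 1 even if
    \<open>D = 0\<close>.\<close>
  have "eventually (\<lambda>x. v (a 0 x - a 0 x0) > ereal r' \<and> (\<forall>j\<in>{..Suc D}. v (a j x - a j x0) > ereal r)) F"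
    using a_tends unfolding vtends_def by (intro eventually_conj eventually_ball_finite) auto
  then show ?thesis
  proof (rule eventually_mono)
    fix x assume x: "v (a 0 x - a 0 x0) > ereal r' \<and> (\<forall>j\<in>{..Suc D}. v (a j x - a j x0) > ereal r)"
    define q where "q = h x \<circ>\<^sub>p [:c, s:]"
    have coeff_q: "coeff q j = a j x * s ^ j" for j
      by (simp add: q_def coeff_taylor a_def)
    have q0: "v (coeff q 0) > v u"
      using x root by (simp add: coeff_q r' a_def)
    have "v (a 1 x) = v \<alpha>"
    proof (rule v_eq_if_close)
      have "v (a 1 x - \<alpha>) > ereal r" using x unfolding \<alpha>_def by simp
      then show "v \<alpha> < v (\<alpha> - a 1 x)" by (simp add: r v_diff_commute[of \<alpha>])
    qed
    then have q1: "v (coeff q 1) = v u"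
      by (simp add: coeff_q u_def v_mult)
    have "v u \<le> v (coeff q (Suc (Suc j)))" for j
    proof (cases "Suc (Suc j) \<le> D")
      case False
      then show ?thesis using a_0[of "Suc (Suc j)" x] by (simp add: coeff_q)
    next
      case True
      let ?j = "Suc (Suc j)"
      have "v ((a ?j x - a ?j x0) * s) > ereal r"
        using x True s_gt by (intro v_mult_gt) auto
      then have "v ((a ?j x - a ?j x0) * s + a ?j x0 * s) > ereal r"
        using \<delta>[OF s_gt(1) True] by (rule v_add_gt)
      then have "v (s * \<alpha>) < v (s * (a ?j x * s))"
        using s(1) r by (simp add: v_cancel_less left_diff_distrib)
      then have "v u \<le> v (s * (a ?j x * s))"
        by (simp add: u_def mult.commute)
      moreover have "0 \<le> v (s ^ j)"
        using s_gt by (induction j) (auto simp: v_mult)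
      ultimately have "v u \<le> v (s * (a ?j x * s) * s ^ j)" by (rule v_mult_ge)
      then show ?thesis by (simp add: coeff_q mult_ac)
    qed
    then have "v u \<le> v (coeff q j)" for j
      using q0 q1 by (metis One_nat_def not0_implies_Suc less_imp_le order_refl)
    moreover have "poly q 0 = coeff q 0" "poly (pderiv q) 0 = coeff q 1"
      by (simp_all add: poly_0_coeff_0 coeff_pderiv)
    ultimately obtain z where z: "poly q z = 0" "v (z - 0) > 0"
      using hensel_scaled[of u q 0] u q0 q1 by auto
    have "v (s * z) > ereal \<gamma>" using s_gt z by (intro v_mult_gt) auto
    moreover have "poly (h x) (c + s * z) = 0"
      using z(1) by (simp add: q_def poly_pcompose mult.commute)
    ultimately show "\<exists>c'. poly (h x) c' = 0 \<and> v (c' - c) > ereal \<gamma>"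
      by (intro exI[of _ "c + s * z"]) simp
  qed
qed

section \<open>Following a root along a piece with constant zero pattern\<close>

text \<open>As \<open>x\<close> and \<open>x'\<close> both range over \<open>B\<close>, the
  implication is an equivalence: along the graph of \<open>f\<close> over \<open>B\<close>, each
  member vanishes everywhere or nowhere.\<close>

definition zero_pattern :: "('x \<Rightarrow> 'k poly) set \<Rightarrow> 'x set \<Rightarrow> ('x \<Rightarrow> 'k) \<Rightarrow> bool" where
  "zero_pattern G B f \<longleftrightarrow>
    (\<forall>g\<in>G. \<forall>x\<in>B. \<forall>x'\<in>B. poly (g x) (f x) = 0 \<longrightarrow> poly (g x') (f x') = 0)"

text \<open>The point \<open>c\<close> is not claimed to be \<open>f x\<close>; that follows only
  when \<open>f\<close> is given by a formula insensitive to \<open>sim\<close>. Any filter along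
  which all coefficient functions converge stands in for a topology on the parameters.\<close>

definition tracks :: "('x \<Rightarrow> 'k poly) set \<Rightarrow> 'x set \<Rightarrow> ('x \<Rightarrow> 'k) \<Rightarrow> bool" where
  "tracks G B f \<longleftrightarrow> (\<forall>x0\<in>B. \<forall>F. (\<forall>a\<in>\<F>. vtends a (a x0) F) \<longrightarrow>
    (\<forall>\<gamma>::real. eventually (\<lambda>x. x \<in> B \<longrightarrow> (\<exists>c. v (c - f x0) > ereal \<gamma> \<and>
      (\<forall>g\<in>G. sim (poly (g x0) (f x0)) (poly (g x) c)))) F))"

lemma tracks_subset: "tracks G B f \<Longrightarrow> G' \<subseteq> G \<Longrightarrow> tracks G' B f"
  unfolding tracks_def
proof (intro ballI allI impI)
  fix x0 F and \<gamma> :: real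
  assume tracks: "\<forall>x0\<in>B. \<forall>F. (\<forall>a\<in>\<F>. vtends a (a x0) F) \<longrightarrow>
      (\<forall>\<gamma>::real. eventually (\<lambda>x. x \<in> B \<longrightarrow> (\<exists>c. v (c - f x0) > ereal \<gamma> \<and>
        (\<forall>g\<in>G. sim (poly (g x0) (f x0)) (poly (g x) c)))) F)"
    and "G' \<subseteq> G" "x0 \<in> B" "\<forall>a\<in>\<F>. vtends a (a x0) F"
  then have "eventually (\<lambda>x. x \<in> B \<longrightarrow> (\<exists>c. v (c - f x0) > ereal \<gamma> \<and>
      (\<forall>g\<in>G. sim (poly (g x0) (f x0)) (poly (g x) c)))) F" by simp
  then show "eventually (\<lambda>x. x \<in> B \<longrightarrow> (\<exists>c. v (c - f x0) > ereal \<gamma> \<and>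
      (\<forall>g\<in>G'. sim (poly (g x0) (f x0)) (poly (g x) c)))) F"
    by (rule eventually_mono) (use \<open>G' \<subseteq> G\<close> in blast)
qed

lemma zero_patternD:
  "zero_pattern G B f \<Longrightarrow> g \<in> G \<Longrightarrow> x \<in> B \<Longrightarrow> x' \<in> B \<Longrightarrow> poly (g x) (f x) = 0 \<Longrightarrow> poly (g x') (f x') = 0"
  unfolding zero_pattern_def by blast

text \<open>The simple root persists as a nearby root \<open>c\<close> of \<open>h x\<close>.
  Members nonzero at \<open>(x0, f x0)\<close> keep their leading terms by continuity; for the
  vanishing ones \<open>zero\<close> says that they still vanish at \<open>c\<close>.\<close>

lemma tracks_simple_root:
  assumes G: "finite G" "G \<subseteq> PF D" and h: "h \<in> PF D"
    and root: "\<And>x. x \<in> B \<Longrightarrow> poly (h x) (f x) = 0"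
    and simple: "\<And>x. x \<in> B \<Longrightarrow> poly (pderiv (h x)) (f x) \<noteq> 0"
    and zero: "\<And>g x0 x c. g \<in> G \<Longrightarrow> x0 \<in> B \<Longrightarrow> x \<in> B \<Longrightarrow> poly (g x0) (f x0) = 0 \<Longrightarrow>
      poly (h x) c = 0 \<Longrightarrow> poly (g x) c = 0"
  shows "tracks G B f"
  unfolding tracks_def
proof (intro ballI allI impI)
  fix x0 F and \<gamma> :: real
  assume x0: "x0 \<in> B" and F: "\<forall>a\<in>\<F>. vtends a (a x0) F"
  let ?c = "f x0"
  let ?G = "{g \<in> G. poly (g x0) ?c \<noteq> 0}"
  have "eventually (\<lambda>z. sim (poly (g x0) ?c) (poly (g (fst z)) (snd z))) (F \<times>\<^sub>F vnhds ?c)"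
    if "g \<in> ?G" for g
    using that G vtends_poly[OF _ F] by (intro vtends_sim) auto
  then have "eventually (\<lambda>z. \<forall>g\<in>?G. sim (poly (g x0) ?c) (poly (g (fst z)) (snd z))) (F \<times>\<^sub>F vnhds ?c)"
    using G(1) by (intro eventually_ball_finite) auto
  then obtain P Q where P: "eventually P F" and Q: "eventually Q (vnhds ?c)"
    and PQ: "\<And>x y. P x \<Longrightarrow> Q y \<Longrightarrow> \<forall>g\<in>?G. sim (poly (g x0) ?c) (poly (g x) y)"
    unfolding eventually_prod_filter by auto
  obtain \<delta> :: real where \<delta>: "\<And>y. v (y - ?c) > ereal \<delta> \<Longrightarrow> Q y"
    using Q unfolding eventually_vnhds by blast
  have "eventually (\<lambda>x. \<exists>c. poly (h x) c = 0 \<and> v (c - ?c) > ereal (max \<gamma> \<delta>)) F"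
    using simple_root_near[OF h F root simple] x0 by blast
  with P show "eventually (\<lambda>x. x \<in> B \<longrightarrow> (\<exists>c. v (c - ?c) > ereal \<gamma> \<and>
      (\<forall>g\<in>G. sim (poly (g x0) ?c) (poly (g x) c)))) F"
  proof (rule eventually_elim2, intro impI)
    fix x assume "P x" and "\<exists>c. poly (h x) c = 0 \<and> v (c - ?c) > ereal (max \<gamma> \<delta>)" and x: "x \<in> B"
    then obtain c where c: "poly (h x) c = 0" "v (c - ?c) > ereal (max \<gamma> \<delta>)" by blast
    have gt: "v (c - ?c) > ereal \<gamma>" "v (c - ?c) > ereal \<delta>"
      using c(2) by (auto elim!: order.strict_trans1[rotated])
    have "sim (poly (g x0) ?c) (poly (g x) c)" if g: "g \<in> G" for g
    proof (cases "poly (g x0) ?c = 0")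
      case True
      then show ?thesis using zero[OF g x0 x _ c(1)] by simp
    next
      case False
      then show ?thesis using PQ[OF \<open>P x\<close> \<delta>[OF gt(2)]] g by blast
    qed
    then show "\<exists>c. v (c - ?c) > ereal \<gamma> \<and> (\<forall>g\<in>G. sim (poly (g x0) ?c) (poly (g x) c))"
      using gt(1) by blast
  qed
qed

text \<open>Descending to a family of minimal degree vanishing along \<open>f\<close> makes \<open>f\<close> a simple root, and
  then any \<open>g\<close> vanishing along \<open>f\<close> vanishes at every root of that family.\<close>

theorem root_tracks:
  assumes "finite G" "G \<subseteq> PF D"
  shows "\<exists>G' D'. finite G' \<and> G \<subseteq> G' \<and> G' \<subseteq> PF D' \<and> (\<forall>B f. zero_pattern G' B f \<longrightarrow>
    (\<exists>h\<in>G \<inter> PF (Suc d). \<exists>x\<in>B. h x \<noteq> 0 \<and> poly (h x) (f x) = 0) \<longrightarrow> tracks G B f)"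
  using assms
proof (induction d arbitrary: G D)
  case 0
  show ?case
  proof (intro exI[of _ G] exI[of _ D] conjI allI impI)
    fix B f assume "\<exists>h\<in>G \<inter> PF (Suc 0). \<exists>x\<in>B. h x \<noteq> 0 \<and> poly (h x) (f x) = 0"
    then obtain h x where "h \<in> PF (Suc 0)" "h x \<noteq> 0" "poly (h x) (f x) = 0" by auto
    then show "tracks G B f" using PF_const_root[of h x "f x"] by simp
  qed (use 0 in auto)
next
  case (Suc d)
  obtain G1 where G1: "finite G1" "G1 \<subseteq> PF (Suc d)"
    and "\<forall>g\<in>G1. \<forall>j. (\<lambda>x. (pderiv ^^ j) (g x)) \<in> G1"
    and reduction: "\<forall>h\<in>G \<inter> PF (Suc (Suc d)). (\<lambda>x. pderiv (h x)) \<in> G1 \<and>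
      (\<exists>r\<in>G1. \<forall>x. coeff (h x) (Suc d) = 0 \<longrightarrow> r x = h x) \<and>
      (\<forall>g\<in>G. \<exists>r\<in>G1. \<exists>N. \<forall>x y. poly (h x) y = 0 \<longrightarrow>
        coeff (h x) (Suc d) ^ N * poly (g x) y = poly (r x) y)"
    using degree_reduction[OF Suc.prems, of d] by (elim exE conjE)
  define E where "E = D + Suc (Suc d)"
  have GE: "G \<subseteq> PF E" "G1 \<subseteq> PF E"
    using Suc.prems(2) G1 PF_mono[of D E] PF_mono[of "Suc d" E] unfolding E_def by auto
  \<comment> \<open>With coefficients added as constant polynomials, the zero pattern also records
    which coefficients vanish, so \<open>h\<close> is nonzero on all of \<open>B\<close> as soon as
    it is nonzero at one point.\<close>
  define K where "K = (\<lambda>(g, i) x. [:coeff (g x) i:]) ` ((G \<union> G1) \<times> {..<E})"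
  have K: "finite K" "K \<subseteq> PF E"
  proof -
    show "finite K" using Suc.prems G1 unfolding K_def by simp
    have "(\<lambda>x. [:coeff (g x) i:]) \<in> PF E" if "g \<in> G \<union> G1" for g i
      using PF_const[OF PF_coeff, of g E i "D + Suc d"] that GE unfolding E_def by auto
    then show "K \<subseteq> PF E" unfolding K_def by auto
  qed
  define G2 where "G2 = G \<union> G1 \<union> K"
  have G2: "finite G2" "G2 \<subseteq> PF E"
    using Suc.prems G1 K GE unfolding G2_def by auto
  obtain G' D' where G': "finite G'" "G2 \<subseteq> G'" "G' \<subseteq> PF D'"
    and IH: "\<forall>B f. zero_pattern G' B f \<longrightarrow>
      (\<exists>h\<in>G2 \<inter> PF (Suc d). \<exists>x\<in>B. h x \<noteq> 0 \<and> poly (h x) (f x) = 0) \<longrightarrow> tracks G2 B f"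
    using Suc.IH[OF G2] by (elim exE conjE)
  have "tracks G B f" if pat: "zero_pattern G' B f"
    and h: "h \<in> G \<inter> PF (Suc (Suc d))" and x1: "x1 \<in> B" "h x1 \<noteq> 0" "poly (h x1) (f x1) = 0"
    for B f h x1
  proof (cases "\<exists>k\<in>G1. \<exists>x\<in>B. k x \<noteq> 0 \<and> poly (k x) (f x) = 0")
    case True
    then have "\<exists>h\<in>G2 \<inter> PF (Suc d). \<exists>x\<in>B. h x \<noteq> 0 \<and> poly (h x) (f x) = 0"
      using G1 unfolding G2_def by blast
    then have "tracks G2 B f" using IH pat by simp
    then show ?thesis by (rule tracks_subset) (auto simp: G2_def)
  next
    case False
    \<comment> \<open>Here \<open>h\<close> has minimal degree: a lower-degree member vanishing at
      \<open>f x\<close> is the zero polynomial at \<open>x\<close>. Applied to the derivative this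
      gives a simple root; applied to a remainder it makes \<open>g\<close> vanish at every root of
      \<open>h x\<close>.\<close>
    then have G1_zero: "k x = 0" if "k \<in> G1" "x \<in> B" "poly (k x) (f x) = 0" for k x
      using that by blast
    have deriv: "(\<lambda>x. pderiv (h x)) \<in> G1"
      and trunc: "\<exists>r\<in>G1. \<forall>x. coeff (h x) (Suc d) = 0 \<longrightarrow> r x = h x"
      and rem: "\<forall>g\<in>G. \<exists>r\<in>G1. \<exists>N. \<forall>x y. poly (h x) y = 0 \<longrightarrow>
        coeff (h x) (Suc d) ^ N * poly (g x) y = poly (r x) y"
      using bspec[OF reduction h] by simp_all
    have hE: "h \<in> PF E" using h GE by blast
    have "h \<in> G'" using h G'(2) unfolding G2_def by blast
    then have root: "poly (h x) (f x) = 0" if "x \<in> B" for x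
      using zero_patternD[OF pat _ x1(1) that, of h] x1(3) by simp
    have nz: "h x \<noteq> 0" if x: "x \<in> B" for x
    proof
      assume "h x = 0"
      have "coeff (h x1) i = 0" for i
      proof (cases "i < E")
        case True
        then have "(\<lambda>x. [:coeff (h x) i:]) \<in> K" using h unfolding K_def by force
        then have "(\<lambda>x. [:coeff (h x) i:]) \<in> G'" using G'(2) unfolding G2_def by blast
        from zero_patternD[OF pat this x x1(1)] show ?thesis using \<open>h x = 0\<close> by simp
      next
        case False
        then show ?thesis using PF_coeff_0[OF hE] by simp
      qed
      then have "h x1 = 0" by (simp add: poly_eq_iff)
      with x1 show False by simp
    qed
    have lc: "coeff (h x) (Suc d) \<noteq> 0" if x: "x \<in> B" for x
    proof
      assume lc: "coeff (h x) (Suc d) = 0"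
      obtain r where r: "r \<in> G1" "\<forall>x. coeff (h x) (Suc d) = 0 \<longrightarrow> r x = h x"
        using trunc by blast
      then have "r x = h x" using lc by blast
      then show False using G1_zero[OF r(1) x] root[OF x] nz[OF x] by simp
    qed
    show ?thesis
    proof (rule tracks_simple_root[OF Suc.prems(1) GE(1) hE root])
      fix x assume x: "x \<in> B"
      show "poly (pderiv (h x)) (f x) \<noteq> 0"
      proof
        assume "poly (pderiv (h x)) (f x) = 0"
        then have "coeff (pderiv (h x)) d = 0" using G1_zero[OF deriv x] by simp
        then show False using lc[OF x] by (simp add: coeff_pderiv del: of_nat_Suc)
      qed
    next
      fix g x0 x c
      assume g: "g \<in> G" and x0: "x0 \<in> B" "poly (g x0) (f x0) = 0"
        and x: "x \<in> B" and c: "poly (h x) c = 0"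
      obtain r N where r: "r \<in> G1" and
        eq: "\<And>x y. poly (h x) y = 0 \<Longrightarrow> coeff (h x) (Suc d) ^ N * poly (g x) y = poly (r x) y"
        using bspec[OF rem g] by blast
      have "g \<in> G'" using g G'(2) unfolding G2_def by blast
      then have "poly (g x) (f x) = 0" using zero_patternD[OF pat _ x0(1) x, of g] x0(2) by simp
      then have "poly (r x) (f x) = 0" using eq[OF root[OF x]] by simp
      then have "r x = 0" using G1_zero[OF r x] by blast
      then show "poly (g x) c = 0" using eq[OF c] lc[OF x] by simp
    qed
  qed
  moreover have "G \<subseteq> G'" using G'(2) unfolding G2_def by blast
  ultimately show ?case using G'(1,3) by (intro exI[of _ G'] exI[of _ D'] conjI allI impI) auto
qed

end

section \<open>Formulas\<close>

primrec kpoly :: "nat \<Rightarrow> kterm \<Rightarrow> (nat \<Rightarrow> 'k::field) \<Rightarrow> 'k poly" where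
  "kpoly n (KVar i) = (\<lambda>e. if i = n then [:0, 1:] else [:e i:])"
| "kpoly n KZero = (\<lambda>e. 0)"
| "kpoly n KOne = (\<lambda>e. [:1:])"
| "kpoly n (KAdd s t) = (\<lambda>e. kpoly n s e + kpoly n t e)"
| "kpoly n (KNeg s) = (\<lambda>e. - kpoly n s e)"
| "kpoly n (KMul s t) = (\<lambda>e. kpoly n s e * kpoly n t e)"

lemma poly_kpoly: "poly (kpoly n t e) a = evalK (e(n := a)) t"
  by (induction t) auto

text \<open>Independence of variable \<open>n\<close> is asked of the value, not of the syntax; it
  lets coefficients be evaluated after variable \<open>n\<close> has been updated.\<close>

definition term_funs :: "nat \<Rightarrow> ((nat \<Rightarrow> 'k::field) \<Rightarrow> 'k) set" where
  "term_funs n = {\<lambda>e. evalK e t | t. \<forall>(e :: nat \<Rightarrow> 'k) a. evalK (e(n := a)) t = evalK e t}"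

lemma term_funsI:
  assumes "\<And>e. f e = evalK e t" and "\<And>e a. f (e(n := a)) = f e"
  shows "f \<in> term_funs n"
proof -
  have "f = (\<lambda>e. evalK e t)" using assms(1) by (rule ext)
  then show ?thesis using assms(2) unfolding term_funs_def by (intro CollectI exI[of _ t]) simp
qed

lemma term_funsE:
  assumes "f \<in> term_funs n"
  obtains t where "f = (\<lambda>e. evalK e t)" "\<And>e a. f (e(n := a)) = f e"
  using assms unfolding term_funs_def by (elim CollectE exE conjE) simp

primrec gvals :: "gterm \<Rightarrow> kterm set" where
  "gvals (GVar i) = {}"
| "gvals GZero = {}"
| "gvals GInf = {}"
| "gvals (GAdd s t) = gvals s \<union> gvals t"
| "gvals (GVal t) = {t}"

primrec racs :: "rterm \<Rightarrow> kterm set" where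
  "racs (RVar i) = {}"
| "racs RZero = {}"
| "racs ROne = {}"
| "racs (RAdd s t) = racs s \<union> racs t"
| "racs (RNeg s) = racs s"
| "racs (RMul s t) = racs s \<union> racs t"
| "racs (RAc t) = {t}"

lemma finite_gvals [simp]: "finite (gvals t)"
  by (induction t) auto

lemma finite_racs [simp]: "finite (racs t)"
  by (induction t) auto

definition env :: "nat \<Rightarrow> (nat \<Rightarrow> 'k) \<Rightarrow> 'k list \<Rightarrow> nat \<Rightarrow> 'k" where
  "env n p xs = (\<lambda>i. if i < n then xs ! i else p i)"

lemma env_snoc: "xs \<in> Kn n \<Longrightarrow> env (Suc n) p (xs @ [a]) = (env n p xs)(n := a)"
  by (auto simp: env_def Kn_def nth_append fun_eq_iff)

lemma map_env: "xs \<in> Kn n \<Longrightarrow> map (env n p xs) [0..<n] = xs"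
  by (auto simp: env_def Kn_def intro!: nth_equalityI)

lemma dp_definable_env:
  "dp_definable v ac relG relR n A \<longleftrightarrow>
     (\<exists>\<phi> pK pG pR. range pG \<subseteq> range v \<and> A = {xs \<in> Kn n. dpsat v ac relG relR \<phi> (env n pK xs) pG pR})"
  unfolding dp_definable_def env_def ..

lemma exists_zero_pattern_formula:
  assumes "finite T"
  shows "\<exists>\<psi>. \<forall>e eG eR. dpsat v ac relG relR \<psi> e eG eR \<longleftrightarrow> (\<forall>t\<in>T. evalK e t = 0 \<longleftrightarrow> t \<in> P)"
  using assms
proof induction
  case empty
  show ?case by (intro exI[of _ "FKEq KZero KZero"]) simp
next
  case (insert t T)
  then obtain \<psi> where \<psi>: "\<forall>e eG eR. dpsat v ac relG relR \<psi> e eG eR \<longleftrightarrow> (\<forall>t\<in>T. evalK e t = 0 \<longleftrightarrow> t \<in> P)"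
    by blast
  show ?case
    by (intro exI[of _ "FAnd (if t \<in> P then FKEq t KZero else FNot (FKEq t KZero)) \<psi>"]) (simp add: \<psi>)
qed

text \<open>The predicate \<open>z\<close> is left abstract to serve both conditions on a point and
  conditions on a point together with its function value.\<close>

lemma pattern_partition:
  fixes z :: "'a \<Rightarrow> 't \<Rightarrow> bool"
  assumes "finite T" and piece_def: "\<And>P. piece P = {x \<in> B. \<forall>t\<in>T. z x t \<longleftrightarrow> t \<in> P}"
  shows "finite (piece ` Pow T)" "\<Union>(piece ` Pow T) = B" "disjoint (piece ` Pow T)"
proof -
  show "finite (piece ` Pow T)" using assms(1) by simp
  show "\<Union>(piece ` Pow T) = B"
  proof (intro equalityI subsetI)
    fix x assume "x \<in> B"
    then show "x \<in> \<Union>(piece ` Pow T)"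
      by (intro UN_I[of "{t \<in> T. z x t}"]) (auto simp: piece_def)
  qed (auto simp: piece_def)
  have "P = Q" if "x \<in> piece P" "x \<in> piece Q" "P \<subseteq> T" "Q \<subseteq> T" for P Q x
    using that unfolding piece_def by blast
  then show "disjoint (piece ` Pow T)" unfolding disjoint_def by blast
qed

context henselian_valuation
begin

lemma poly_families_term_funs: "poly_families v (term_funs n)"
proof
  show "(\<lambda>_. 0) \<in> (term_funs n :: ((nat \<Rightarrow> 'k) \<Rightarrow> 'k) set)"
    by (rule term_funsI[of _ KZero]) auto
  show "(\<lambda>_. 1) \<in> (term_funs n :: ((nat \<Rightarrow> 'k) \<Rightarrow> 'k) set)"
    by (rule term_funsI[of _ KOne]) auto
  fix a b :: "(nat \<Rightarrow> 'k) \<Rightarrow> 'k" assume "a \<in> term_funs n"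
  then obtain s where a: "a = (\<lambda>e. evalK e s)" "\<And>e c. a (e(n := c)) = a e" by (rule term_funsE) blast
  show "(\<lambda>x. - a x) \<in> term_funs n"
    by (rule term_funsI[of _ "KNeg s"]) (simp_all add: a(2), simp add: a(1))
  assume "b \<in> term_funs n"
  then obtain t where b: "b = (\<lambda>e. evalK e t)" "\<And>e c. b (e(n := c)) = b e" by (rule term_funsE) blast
  show "(\<lambda>x. a x + b x) \<in> term_funs n"
    by (rule term_funsI[of _ "KAdd s t"]) (simp_all add: a(2) b(2), simp add: a(1) b(1))
  show "(\<lambda>x. a x * b x) \<in> term_funs n"
    by (rule term_funsI[of _ "KMul s t"]) (simp_all add: a(2) b(2), simp add: a(1) b(1))
qed

interpretation terms: poly_families v "term_funs n" for n
  by (rule poly_families_term_funs)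

lemma kpoly_PF: "\<exists>d. kpoly n t \<in> terms.PF n d"
proof (induction t)
  case (KVar i)
  show ?case
  proof (cases "i = n")
    case True
    have "(\<lambda>e. coeff [:0, 1::'k:] j) \<in> term_funs n" for j
      using terms.F_0[of n] terms.F_1[of n] by (cases j; cases "j - 1") auto
    then have "kpoly n (KVar i) \<in> terms.PF n 2"
      using True by (auto simp: terms.PF_def coeff_pCons split: nat.split)
    then show ?thesis by blast
  next
    case False
    have "(\<lambda>e. e i) \<in> (term_funs n :: ((nat \<Rightarrow> 'k) \<Rightarrow> 'k) set)"
      using False by (intro term_funsI[of _ "KVar i"]) auto
    from terms.PF_const[OF this, of 0] show ?thesis using False by (intro exI[of _ "Suc 0"]) simp
  qed
next
  case KZero
  show ?case using terms.PF_0 by (intro exI[of _ 0]) simp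
next
  case KOne
  show ?case using terms.PF_const[OF terms.F_1, of n 0] by (intro exI[of _ "Suc 0"]) simp
next
  case (KAdd s t)
  then obtain d d' where d: "kpoly n s \<in> terms.PF n d" "kpoly n t \<in> terms.PF n d'" by blast
  then have "kpoly n s \<in> terms.PF n (d + d')" "kpoly n t \<in> terms.PF n (d + d')"
    using terms.PF_mono[of d "d + d'" n] terms.PF_mono[of d' "d + d'" n] by auto
  from terms.PF_add[OF this] show ?case by (intro exI[of _ "d + d'"]) simp
next
  case (KNeg s)
  then obtain d where "kpoly n s \<in> terms.PF n d" by blast
  from terms.PF_uminus[OF this] show ?case by (intro exI[of _ d]) simp
next
  case (KMul s t)
  then obtain d d' where d: "kpoly n s \<in> terms.PF n d" "kpoly n t \<in> terms.PF n d'" by blast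
  from terms.PF_mult[OF this] show ?case by (intro exI[of _ "d + d'"]) simp
qed

lemma finite_kpoly_PF: "finite T \<Longrightarrow> \<exists>D. kpoly n ` T \<subseteq> terms.PF n D"
proof (induction T rule: finite_induct)
  case (insert t T)
  then obtain D where D: "kpoly n ` T \<subseteq> terms.PF n D" by blast
  obtain d where "kpoly n t \<in> terms.PF n d" using kpoly_PF by blast
  with D have "kpoly n ` insert t T \<subseteq> terms.PF n (D + d)"
    using terms.PF_mono[of D "D + d" n] terms.PF_mono[of d "D + d" n] by auto
  then show ?case by blast
qed simp

text \<open>Converse passage to \<open>kpoly\<close>: the families produced by
  \<open>root_tracks\<close> must become terms again for their zero patterns to be
  definable.\<close>

lemma PF_term:
  assumes "g \<in> terms.PF n d"
  shows "\<exists>t. \<forall>e a. evalK (e(n := a)) t = poly (g e) a"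
proof -
  have "\<exists>t. \<forall>e a. evalK (e(n := a)) t = (\<Sum>i<m. coeff (g e) i * a ^ i)" for m
  proof (induction m)
    case 0
    show ?case by (intro exI[of _ KZero]) simp
  next
    case (Suc m)
    then obtain t where t: "\<forall>e a. evalK (e(n := a)) t = (\<Sum>i<m. coeff (g e) i * a ^ i)" by blast
    obtain s where s: "(\<lambda>e. coeff (g e) m) = (\<lambda>e. evalK e s)"
        "\<And>e a. coeff (g (e(n := a))) m = coeff (g e) m"
      using term_funsE[OF terms.PF_coeff[OF assms, of m]] by blast
    have s': "evalK (e(n := a)) s = coeff (g e) m" for e a
      using s(2)[of e a] fun_cong[OF s(1), of "e(n := a)"] by simp
    have "\<exists>p. \<forall>e. evalK e p = (e n :: 'k) ^ m"
    proof (induction m)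
      case 0
      show ?case by (intro exI[of _ KOne]) simp
    next
      case (Suc m)
      then obtain p where "\<forall>e. evalK e p = (e n :: 'k) ^ m" by blast
      then show ?case by (intro exI[of _ "KMul (KVar n) p"]) simp
    qed
    then obtain p where p: "\<And>e. evalK e p = (e n :: 'k) ^ m" by blast
    show ?case
      by (intro exI[of _ "KAdd t (KMul s p)"] allI)
        (simp only: evalK.simps t[rule_format] s' p fun_upd_same sum.lessThan_Suc)
  qed
  then show ?thesis unfolding terms.PF_poly_altdef[OF assms] .
qed

lemma evalG_sim:
  "(\<forall>t\<in>gvals s. sim (evalK e t) (evalK e' t)) \<Longrightarrow> evalG v e eG s = evalG v e' eG s"
  by (induction s) (auto dest: sim_v)

lemma evalR_sim:
  assumes "\<forall>a b. sim a b \<longrightarrow> ac a = ac b"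
  shows "(\<forall>t\<in>racs s. sim (evalK e t) (evalK e' t)) \<Longrightarrow> evalR ac e eR s = evalR ac e' eR s"
  by (induction s) (auto dest: assms[rule_format])

text \<open>Quantifier elimination in semantic form: the truth of a formula depends only on the classes
  of finitely many terms, uniformly in the auxiliary sorts, so quantifiers over those sorts cost
  nothing.\<close>

theorem dpsat_sim_invariant:
  fixes \<phi> :: "('i, 'j) dpfm" and ac :: "'k \<Rightarrow> 'r::field"
  assumes ac: "\<forall>a b. sim a b \<longrightarrow> ac a = ac b"
  shows "\<exists>T. finite T \<and> (\<forall>e e' eG eR. (\<forall>t\<in>T. sim (evalK e t) (evalK e' t)) \<longrightarrow>
    dpsat v ac relG relR \<phi> e eG eR = dpsat v ac relG relR \<phi> e' eG eR)"
proof (induction \<phi>)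
  case (FKEq s t)
  have "evalK e s = evalK e t \<longleftrightarrow> evalK e (KAdd s (KNeg t)) = 0" for e :: "nat \<Rightarrow> 'k"
    by simp
  then show ?case
    by (intro exI[of _ "{KAdd s (KNeg t)}"]) (auto dest: sim_0 simp del: evalK.simps simp: dpsat.simps)
next
  case (FGEq s t)
  have "dpsat v ac relG relR (FGEq s t) e eG eR = dpsat v ac relG relR (FGEq s t) e' eG eR"
    if "\<forall>t\<in>gvals s \<union> gvals t. sim (evalK e t) (evalK e' t)" for e e' eG eR
    using that evalG_sim[of s e e' eG] evalG_sim[of t e e' eG] by (simp add: ball_Un)
  then show ?case by (intro exI[of _ "gvals s \<union> gvals t"]) auto
next
  case (FGLess s t)
  have "dpsat v ac relG relR (FGLess s t) e eG eR = dpsat v ac relG relR (FGLess s t) e' eG eR"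
    if "\<forall>t\<in>gvals s \<union> gvals t. sim (evalK e t) (evalK e' t)" for e e' eG eR
    using that evalG_sim[of s e e' eG] evalG_sim[of t e e' eG] by (simp add: ball_Un)
  then show ?case by (intro exI[of _ "gvals s \<union> gvals t"]) auto
next
  case (FREq s t)
  have "dpsat v ac relG relR (FREq s t) e eG eR = dpsat v ac relG relR (FREq s t) e' eG eR"
    if "\<forall>t\<in>racs s \<union> racs t. sim (evalK e t) (evalK e' t)" for e e' eG eR
    using that evalR_sim[OF ac, of s e e' eR] evalR_sim[OF ac, of t e e' eR] by (simp add: ball_Un)
  then show ?case by (intro exI[of _ "racs s \<union> racs t"]) auto
next
  case (FGRel i ts)
  have "dpsat v ac relG relR (FGRel i ts) e eG eR = dpsat v ac relG relR (FGRel i ts) e' eG eR"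
    if "\<forall>t\<in>\<Union>(gvals ` set ts). sim (evalK e t) (evalK e' t)" for e e' eG eR
  proof -
    have "map (evalG v e eG) ts = map (evalG v e' eG) ts"
      using that by (intro map_cong evalG_sim) auto
    then show ?thesis by (simp only: dpsat.simps)
  qed
  then show ?case by (intro exI[of _ "\<Union>(gvals ` set ts)"]) auto
next
  case (FRRel j ts)
  have "dpsat v ac relG relR (FRRel j ts) e eG eR = dpsat v ac relG relR (FRRel j ts) e' eG eR"
    if "\<forall>t\<in>\<Union>(racs ` set ts). sim (evalK e t) (evalK e' t)" for e e' eG eR
  proof -
    have "map (evalR ac e eR) ts = map (evalR ac e' eR) ts"
      using that by (intro map_cong evalR_sim[OF ac]) auto
    then show ?thesis by (simp only: dpsat.simps)
  qed
  then show ?case by (intro exI[of _ "\<Union>(racs ` set ts)"]) auto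
next
  case (FNot \<phi>)
  then show ?case by simp
next
  case (FAnd \<phi> \<psi>)
  then obtain T T' where T: "finite T" "\<forall>e e' eG eR. (\<forall>t\<in>T. sim (evalK e t) (evalK e' t)) \<longrightarrow>
      dpsat v ac relG relR \<phi> e eG eR = dpsat v ac relG relR \<phi> e' eG eR"
    and T': "finite T'" "\<forall>e e' eG eR. (\<forall>t\<in>T'. sim (evalK e t) (evalK e' t)) \<longrightarrow>
      dpsat v ac relG relR \<psi> e eG eR = dpsat v ac relG relR \<psi> e' eG eR"
    by (elim exE conjE)
  show ?case
  proof (intro exI[of _ "T \<union> T'"] conjI allI impI)
    fix e e' eG eR assume "\<forall>t\<in>T \<union> T'. sim (evalK e t) (evalK e' t)"
    then show "dpsat v ac relG relR (FAnd \<phi> \<psi>) e eG eR = dpsat v ac relG relR (FAnd \<phi> \<psi>) e' eG eR"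
      using T(2)[rule_format, of e e' eG eR] T'(2)[rule_format, of e e' eG eR] by simp
  qed (use T T' in simp)
next
  case (FExK n \<phi>)
  then obtain T where T: "finite T" "\<forall>e e' eG eR. (\<forall>t\<in>T. sim (evalK e t) (evalK e' t)) \<longrightarrow>
      dpsat v ac relG relR \<phi> e eG eR = dpsat v ac relG relR \<phi> e' eG eR"
    by (elim exE conjE)
  obtain D where D: "kpoly n ` T \<subseteq> terms.PF n D" using finite_kpoly_PF[OF T(1)] by blast
  obtain H where H: "finite H" "H \<subseteq> term_funs n" and
    transfer: "\<forall>x x'. (\<forall>a\<in>H. sim (a x) (a x')) \<longrightarrow>
      (\<forall>c. \<exists>c'. \<forall>g\<in>kpoly n ` T. sim (poly (g x) c) (poly (g x') c'))"
    using terms.point_transfer[OF finite_imageI[OF T(1)] D] by (elim exE conjE)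
  \<comment> \<open>Since \<open>H\<close> lies in \<open>term_funs\<close>, the conditions left
    after the quantifier are again finitely many terms.\<close>
  have "H \<subseteq> (\<lambda>t e. evalK e t) ` UNIV"
    using H(2) unfolding term_funs_def by blast
  from finite_subset_image[OF H(1) this]
  obtain T' where T': "finite T'" "H = (\<lambda>t e. evalK e t) ` T'"
    by (elim exE conjE)
  have step: "dpsat v ac relG relR (FExK n \<phi>) e' eG eR"
    if e: "\<forall>t\<in>T'. sim (evalK e t) (evalK e' t)" and sat: "dpsat v ac relG relR (FExK n \<phi>) e eG eR"
    for e e' eG eR
  proof -
    obtain c where c: "dpsat v ac relG relR \<phi> (e(n := c)) eG eR" using sat by auto
    have "\<forall>a\<in>H. sim (a e) (a e')" using e unfolding T' by simp
    from transfer[THEN spec, THEN spec, THEN mp, OF this, THEN spec[where x = c]]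
    obtain c' where "\<forall>g\<in>kpoly n ` T. sim (poly (g e) c) (poly (g e') c')"
      by (elim exE)
    then have "\<forall>t\<in>T. sim (evalK (e(n := c)) t) (evalK (e'(n := c')) t)"
      by (simp add: poly_kpoly)
    then have "dpsat v ac relG relR \<phi> (e'(n := c')) eG eR"
      using T(2)[rule_format, of "e(n := c)" "e'(n := c')" eG eR] c by simp
    then show ?thesis by auto
  qed
  show ?case
  proof (intro exI[of _ T'] conjI allI impI T'(1) iffI)
    fix e e' eG eR assume e: "\<forall>t\<in>T'. sim (evalK e t) (evalK e' t)"
    then have e': "\<forall>t\<in>T'. sim (evalK e' t) (evalK e t)" using sim_sym by blast
    show "dpsat v ac relG relR (FExK n \<phi>) e' eG eR" if "dpsat v ac relG relR (FExK n \<phi>) e eG eR"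
      using step[OF e that] .
    show "dpsat v ac relG relR (FExK n \<phi>) e eG eR" if "dpsat v ac relG relR (FExK n \<phi>) e' eG eR"
      using step[OF e' that] .
  qed
next
  case (FExG n \<phi>)
  then obtain T where T: "finite T" "\<forall>e e' eG eR. (\<forall>t\<in>T. sim (evalK e t) (evalK e' t)) \<longrightarrow>
      dpsat v ac relG relR \<phi> e eG eR = dpsat v ac relG relR \<phi> e' eG eR"
    by (elim exE conjE)
  show ?case
  proof (intro exI[of _ T] conjI allI impI T(1))
    fix e e' eG eR assume "\<forall>t\<in>T. sim (evalK e t) (evalK e' t)"
    then have "dpsat v ac relG relR \<phi> e (eG(n := g)) eR = dpsat v ac relG relR \<phi> e' (eG(n := g)) eR" for g
      using T(2) by simp
    then show "dpsat v ac relG relR (FExG n \<phi>) e eG eR = dpsat v ac relG relR (FExG n \<phi>) e' eG eR"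
      by simp
  qed
next
  case (FExR n \<phi>)
  then obtain T where T: "finite T" "\<forall>e e' eG eR. (\<forall>t\<in>T. sim (evalK e t) (evalK e' t)) \<longrightarrow>
      dpsat v ac relG relR \<phi> e eG eR = dpsat v ac relG relR \<phi> e' eG eR"
    by (elim exE conjE)
  show ?case
  proof (intro exI[of _ T] conjI allI impI T(1))
    fix e e' eG eR assume "\<forall>t\<in>T. sim (evalK e t) (evalK e' t)"
    then have "dpsat v ac relG relR \<phi> e eG (eR(n := c)) = dpsat v ac relG relR \<phi> e' eG (eR(n := c))" for c
      using T(2) by simp
    then show "dpsat v ac relG relR (FExR n \<phi>) e eG eR = dpsat v ac relG relR (FExR n \<phi>) e' eG eR"
      by simp
  qed
qed

section \<open>The topology of \<open>K^n\<close> through environments\<close>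

text \<open>Closeness is uniform over infinitely many variables, which costs nothing: environments
  \<open>env n p xs\<close> share their parameters from index \<open>n\<close> on.\<close>

definition env_nhds :: "(nat \<Rightarrow> 'k) \<Rightarrow> (nat \<Rightarrow> 'k) filter" where
  "env_nhds e = (INF \<gamma>::real. principal {e'. \<forall>i. v (e' i - e i) > ereal \<gamma>})"

lemma eventually_env_nhds:
  "eventually P (env_nhds e) \<longleftrightarrow> (\<exists>\<gamma>::real. \<forall>e'. (\<forall>i. v (e' i - e i) > ereal \<gamma>) \<longrightarrow> P e')"
proof -
  have "\<exists>k\<in>UNIV. principal {e'. \<forall>l. ereal k < v (e' l - e l)} \<le> principal {e'. \<forall>l. ereal i < v (e' l - e l)} \<and>
     principal {e'. \<forall>l. ereal k < v (e' l - e l)} \<le> principal {e'. \<forall>l. ereal j < v (e' l - e l)}"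
    for i j :: real
    by (rule bexI[of _ "max i j"]) auto
  then show ?thesis
    unfolding env_nhds_def by (subst eventually_INF_base) (auto simp: eventually_principal)
qed

lemma vtends_evalK: "vtends (\<lambda>e. evalK e t) (evalK e0 t) (env_nhds e0)"
proof (induction t)
  case (KVar i)
  show ?case by (auto simp: vtends_def eventually_env_nhds)
qed (simp_all add: vtends_const vtends_add vtends_uminus vtends_mult)

lemma vtends_term_funs: "\<forall>a\<in>term_funs n. vtends a (a e) (env_nhds e)"
proof
  fix a :: "(nat \<Rightarrow> 'k) \<Rightarrow> 'k" assume "a \<in> term_funs n"
  then obtain t where "a = (\<lambda>e. evalK e t)" by (rule term_funsE)
  then show "vtends a (a e) (env_nhds e)" using vtends_evalK by simp
qed

lemma eventually_env_nhdsD: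
  assumes "eventually P (env_nhds (env n p xs))"
  shows "\<exists>\<gamma>::real. \<forall>ys\<in>Kn n. (\<forall>i<n. v (ys ! i - xs ! i) > ereal \<gamma>) \<longrightarrow> P (env n p ys)"
proof -
  obtain \<gamma> :: real where \<gamma>: "\<And>e. (\<forall>i. v (e i - env n p xs i) > ereal \<gamma>) \<Longrightarrow> P e"
    using assms unfolding eventually_env_nhds by blast
  have "P (env n p ys)" if "\<forall>i<n. v (ys ! i - xs ! i) > ereal \<gamma>" for ys
    using that by (intro \<gamma>) (auto simp: env_def)
  then show ?thesis by blast
qed

lemma Kn_openI:
  assumes "U \<subseteq> Kn n"
    and "\<And>xs. xs \<in> U \<Longrightarrow> eventually (\<lambda>e. \<forall>ys\<in>Kn n. e = env n p ys \<longrightarrow> ys \<in> U) (env_nhds (env n p xs))"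
  shows "Kn_open v n U"
  unfolding Kn_open_def
proof (intro conjI ballI assms(1))
  fix xs assume "xs \<in> U"
  from eventually_env_nhdsD[OF assms(2)[OF this]]
  show "\<exists>\<gamma>::real. \<forall>ys\<in>Kn n. (\<forall>i<n. v (ys ! i - xs ! i) > ereal \<gamma>) \<longrightarrow> ys \<in> U"
    by auto
qed

text \<open>The vanishing terms cut out the closed set \<open>C\<close>. The other terms have
  locally constant leading terms, so sharing these with some point of the piece is the open
  condition \<open>U\<close>. On the intersection all terms of \<open>T\<close> are similar, and
  \<open>inv\<close> brings the point back into \<open>B\<close>.\<close>

lemma locally_closed_zero_pattern:
  assumes T: "finite T" and B: "B \<subseteq> Kn n" and P: "P \<subseteq> T"
    and inv: "\<And>xs ys. xs \<in> B \<Longrightarrow> ys \<in> Kn n \<Longrightarrow>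
      \<forall>t\<in>T. sim (evalK (env n p xs) t) (evalK (env n p ys) t) \<Longrightarrow> ys \<in> B"
  shows "locally_closed v n {xs \<in> B. \<forall>t\<in>T. evalK (env n p xs) t = 0 \<longleftrightarrow> t \<in> P}"
proof -
  let ?e = "\<lambda>t xs. evalK (env n p xs) t"
  let ?B = "{xs \<in> B. \<forall>t\<in>T. ?e t xs = 0 \<longleftrightarrow> t \<in> P}"
  define U where "U = {ys \<in> Kn n. \<exists>xs\<in>?B. \<forall>t\<in>T - P. sim (?e t xs) (?e t ys)}"
  define C where "C = {ys \<in> Kn n. \<forall>t\<in>P. ?e t ys = 0}"
  have near: "eventually (\<lambda>e. sim (?e t xs) (evalK e t)) (env_nhds (env n p xs))" if "?e t xs \<noteq> 0" for t xs
    using vtends_sim[OF vtends_evalK that] .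
  have "Kn_open v n U"
  proof (rule Kn_openI[where p = p])
    show "U \<subseteq> Kn n" by (auto simp: U_def)
    fix ys assume "ys \<in> U"
    then obtain xs where xs: "xs \<in> ?B" "\<forall>t\<in>T - P. sim (?e t xs) (?e t ys)" by (auto simp: U_def)
    have "?e t ys \<noteq> 0" if "t \<in> T - P" for t
      using xs that sim_0[of "?e t xs" "?e t ys"] by auto
    then have "eventually (\<lambda>e. \<forall>t\<in>T - P. sim (?e t ys) (evalK e t)) (env_nhds (env n p ys))"
      using T near by (intro eventually_ball_finite) auto
    then show "eventually (\<lambda>e. \<forall>zs\<in>Kn n. e = env n p zs \<longrightarrow> zs \<in> U) (env_nhds (env n p ys))"
    proof (rule eventually_mono, intro ballI impI)
      fix e zs assume "\<forall>t\<in>T - P. sim (?e t ys) (evalK e t)" "zs \<in> Kn n" "e = env n p zs"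
      then have "\<forall>t\<in>T - P. sim (?e t xs) (?e t zs)" using xs(2) sim_trans by blast
      then show "zs \<in> U" using xs(1) \<open>zs \<in> Kn n\<close> unfolding U_def by blast
    qed
  qed
  moreover have "Kn_closed v n C"
    unfolding Kn_closed_def
  proof
    show "C \<subseteq> Kn n" by (auto simp: C_def)
    show "Kn_open v n (Kn n - C)"
    proof (rule Kn_openI[where p = p])
      fix xs assume "xs \<in> Kn n - C"
      then obtain t where t: "t \<in> P" "?e t xs \<noteq> 0" by (auto simp: C_def)
      show "eventually (\<lambda>e. \<forall>ys\<in>Kn n. e = env n p ys \<longrightarrow> ys \<in> Kn n - C) (env_nhds (env n p xs))"
        using near[OF t(2)]
      proof (rule eventually_mono, intro ballI impI)
        fix e ys assume "sim (?e t xs) (evalK e t)" "ys \<in> Kn n" "e = env n p ys"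
        then show "ys \<in> Kn n - C" using t sim_0[of "?e t xs" "?e t ys"] by (auto simp: C_def)
      qed
    qed auto
  qed
  moreover have "?B = U \<inter> C"
  proof (intro equalityI subsetI)
    fix xs assume "xs \<in> ?B"
    moreover then have "xs \<in> Kn n" using B by blast
    ultimately show "xs \<in> U \<inter> C" using P unfolding U_def C_def by auto
  next
    fix ys assume "ys \<in> U \<inter> C"
    then obtain xs where xs: "xs \<in> ?B" "\<forall>t\<in>T - P. sim (?e t xs) (?e t ys)"
      and ys: "ys \<in> Kn n" "\<forall>t\<in>P. ?e t ys = 0" by (auto simp: U_def C_def)
    have sim: "sim (?e t xs) (?e t ys)" if "t \<in> T" for t
      using xs ys that by (cases "t \<in> P") auto
    then have "ys \<in> B" using inv[of xs ys] xs(1) ys(1) by blast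
    moreover have "?e t ys = 0 \<longleftrightarrow> t \<in> P" if "t \<in> T" for t
      using sim_0[OF sim[OF that]] xs(1) that by auto
    ultimately show "ys \<in> ?B" by blast
  qed
  ultimately show ?thesis unfolding locally_closed_def by blast
qed

text \<open>A union of balls around the points of \<open>S\<close> is open because any point of an
  ultrametric ball is a center of it.\<close>

lemma relatively_open:
  assumes S: "S \<subseteq> B" "B \<subseteq> Kn n"
    and near: "\<And>xs. xs \<in> S \<Longrightarrow> \<exists>\<gamma>::real. \<forall>ys\<in>B. (\<forall>i<n. v (ys ! i - xs ! i) > ereal \<gamma>) \<longrightarrow> ys \<in> S"
  shows "\<exists>U. Kn_open v n U \<and> S = U \<inter> B"
proof -
  define N where "N \<gamma> xs ys \<longleftrightarrow> (\<forall>i<n. v (ys ! i - xs ! i) > ereal \<gamma>)" for \<gamma> :: real and xs ys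
  have N_trans: "N \<gamma> xs zs" if "N \<gamma> xs ys" "N \<gamma> ys zs" for \<gamma> xs ys zs
    unfolding N_def
  proof (intro allI impI)
    fix i assume "i < n"
    then have "ereal \<gamma> < v ((zs ! i - ys ! i) + (ys ! i - xs ! i))"
      using that unfolding N_def by (intro v_add_gt) auto
    then show "ereal \<gamma> < v (zs ! i - xs ! i)" by simp
  qed
  define U where "U = {ys \<in> Kn n. \<exists>xs\<in>S. \<exists>\<gamma>. N \<gamma> xs ys \<and> (\<forall>zs\<in>B. N \<gamma> xs zs \<longrightarrow> zs \<in> S)}"
  have "\<exists>\<gamma>. \<forall>zs\<in>Kn n. N \<gamma> ys zs \<longrightarrow> zs \<in> U" if "ys \<in> U" for ys
    using that N_trans unfolding U_def by blast
  then have "Kn_open v n U"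
    unfolding Kn_open_def N_def by (auto simp: U_def)
  moreover have "S = U \<inter> B"
  proof (intro equalityI subsetI)
    fix xs assume xs: "xs \<in> S"
    obtain \<gamma> where "\<forall>ys\<in>B. N \<gamma> xs ys \<longrightarrow> ys \<in> S" using near[OF xs] unfolding N_def by blast
    moreover have "N \<gamma> xs xs" by (simp add: N_def)
    ultimately show "xs \<in> U \<inter> B" using xs S unfolding U_def by blast
  next
    fix ys assume "ys \<in> U \<inter> B"
    then show "ys \<in> S" unfolding U_def by blast
  qed
  ultimately show ?thesis by blast
qed

section \<open>Definable partitions\<close>

lemma definable_zero_pattern:
  assumes B: "B = {xs \<in> Kn n. dpsat v ac relG relR \<phi> (env n pK xs) pG pR}" and pG: "range pG \<subseteq> range v"
    and T: "finite T"
  shows "dp_definable v ac relG relR n {xs \<in> B. \<forall>t\<in>T. evalK (env n pK xs) t = 0 \<longleftrightarrow> t \<in> P}"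
proof -
  obtain \<psi> where \<psi>: "\<forall>e eG eR. dpsat v ac relG relR \<psi> e eG eR \<longleftrightarrow> (\<forall>t\<in>T. evalK e t = 0 \<longleftrightarrow> t \<in> P)"
    using exists_zero_pattern_formula[where v = v and ac = ac and relG = relG and relR = relR and P = P, OF T] by (elim exE)
  have "{xs \<in> B. \<forall>t\<in>T. evalK (env n pK xs) t = 0 \<longleftrightarrow> t \<in> P} =
      {xs \<in> Kn n. dpsat v ac relG relR (FAnd \<phi> \<psi>) (env n pK xs) pG pR}"
    unfolding B by (auto simp: \<psi>)
  then show ?thesis unfolding dp_definable_env using pG by blast
qed

text \<open>The terms deciding the formula of \<open>B\<close> also do the cutting, so
  \<open>B\<close> is invariant under \<open>sim\<close> on them, as
  \<open>locally_closed_zero_pattern\<close> requires.\<close>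

lemma definable_locally_closed_partition:
  fixes ac :: "'k \<Rightarrow> 'r::field"
  assumes ac: "\<forall>a b. sim a b \<longrightarrow> ac a = ac b" and "dp_definable v ac relG relR n B"
  shows "\<exists>\<B>. finite \<B> \<and> \<Union>\<B> = B \<and> disjoint \<B> \<and>
    (\<forall>C\<in>\<B>. dp_definable v ac relG relR n C \<and> locally_closed v n C)"
proof -
  obtain \<phi> pK pG pR where pG: "range pG \<subseteq> range v"
    and B: "B = {xs \<in> Kn n. dpsat v ac relG relR \<phi> (env n pK xs) pG pR}"
    using assms(2) unfolding dp_definable_env by (elim exE conjE)
  obtain T where T: "finite T" "\<forall>e e' eG eR. (\<forall>t\<in>T. sim (evalK e t) (evalK e' t)) \<longrightarrow>
    dpsat v ac relG relR \<phi> e eG eR = dpsat v ac relG relR \<phi> e' eG eR"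
    using dpsat_sim_invariant[OF ac, where \<phi> = \<phi> and relG = relG and relR = relR] by (elim exE conjE)
  define piece where "piece P = {xs \<in> B. \<forall>t\<in>T. evalK (env n pK xs) t = 0 \<longleftrightarrow> t \<in> P}" for P
  have "locally_closed v n (piece P)" if "P \<subseteq> T" for P
    unfolding piece_def
  proof (rule locally_closed_zero_pattern[OF T(1) _ that])
    fix xs ys assume "xs \<in> B" "ys \<in> Kn n"
      and sim: "\<forall>t\<in>T. sim (evalK (env n pK xs) t) (evalK (env n pK ys) t)"
    then show "ys \<in> B" using T(2)[THEN spec, THEN spec, THEN spec, THEN spec, THEN mp, OF sim] unfolding B by simp
  qed (auto simp: B)
  moreover have "dp_definable v ac relG relR n (piece P)" for P
    unfolding piece_def using definable_zero_pattern[OF B pG T(1)] .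
  ultimately show ?thesis
    using pattern_partition[OF T(1) piece_def] by (intro exI[of _ "piece ` Pow T"] conjI ballI) auto
qed

section \<open>Definable functions\<close>

text \<open>Away from its closest center, \<open>c\<close> can be moved by a small
  \<open>\<epsilon>\<close> without changing the leading terms of \<open>T\<close>. The moved point
  would satisfy \<open>S\<close> too, against uniqueness.\<close>

lemma definable_function_value_is_root:
  assumes inv: "\<forall>e e' eG eR. (\<forall>t\<in>T. sim (evalK e t) (evalK e' t)) \<longrightarrow> S e eG eR = S e' eG eR"
    and T: "finite T" "KVar n \<in> T" and c: "S (e(n := c)) eG eR"
    and unique: "\<And>c'. S (e(n := c')) eG eR \<Longrightarrow> c' = c"
  shows "c \<in> terms.roots (terms.derivs (kpoly n ` T)) e"
proof -
  let ?G = "terms.derivs (kpoly n ` T)"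
  obtain D where D: "kpoly n ` T \<subseteq> terms.PF n D" using finite_kpoly_PF[OF T(1)] by blast
  have G: "finite ?G" using terms.finite_derivs[OF finite_imageI[OF T(1)] D] .
  have sub: "kpoly n ` T \<subseteq> ?G" by (rule terms.subset_derivs)
  \<comment> \<open>The variable itself contributes the root 0, so the extra center 0 is a root as
    well.\<close>
  have "kpoly n (KVar n) \<in> ?G" using sub T(2) by blast
  then have "0 \<in> terms.roots ?G e" by (rule terms.rootsI) auto
  then have insert: "insert 0 (terms.roots ?G e) = terms.roots ?G e" by blast
  obtain b where b: "b \<in> insert 0 (terms.roots ?G e)"
    and closest: "\<And>z. z \<in> insert 0 (terms.roots ?G e) \<Longrightarrow> v (c - z) \<le> v (c - b)"
    using terms.closest_center[OF G] by blast
  have "c = b"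
  proof (rule ccontr)
    assume "c \<noteq> b"
    then obtain r where r: "v (c - b) = ereal r" using v_finite[of "c - b"] by auto
    obtain \<epsilon> where \<epsilon>: "\<epsilon> \<noteq> 0" "v \<epsilon> > ereal r" using exists_v_gt by blast
    have t: "sim (c - b) (c - b + \<epsilon>)"
      using \<epsilon> r v_minus[of \<epsilon>] by (simp add: sim_def)
    have "sim (poly (g e) c) (poly (g e) (b + (c - b + \<epsilon>)))" if "g \<in> ?G" for g
      by (rule terms.sim_at_closest_center[where G = ?G, OF terms.derivs_closed closest \<open>c \<noteq> b\<close> sim_refl t that])
    then have "sim (poly (kpoly n t e) c) (poly (kpoly n t e) (c + \<epsilon>))" if "t \<in> T" for t
      using sub that by auto
    then have "\<forall>t\<in>T. sim (evalK (e(n := c)) t) (evalK (e(n := c + \<epsilon>)) t)"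
      by (simp add: poly_kpoly)
    then have "S (e(n := c + \<epsilon>)) eG eR" using inv c by blast
    then show False using unique[of "c + \<epsilon>"] \<epsilon> by simp
  qed
  then show ?thesis using b insert by simp
qed

lemma definable_function_continuous_partition:
  fixes ac :: "'k \<Rightarrow> 'r::field"
  assumes ac: "\<forall>a b. sim a b \<longrightarrow> ac a = ac b" and A: "A \<subseteq> Kn n"
    and "dp_definable v ac relG relR (Suc n) {xs @ [a] | xs a. xs \<in> A \<and> f xs = Some a}"
  shows "\<exists>\<B>. finite \<B> \<and> \<Union>\<B> = {xs \<in> A. f xs \<noteq> None} \<and> disjoint \<B> \<and>
    (\<forall>C\<in>\<B>. dp_definable v ac relG relR n C \<and> continuous_on_P1 v n C f)"
proof -
  obtain \<phi> pK pG pR where pG: "range pG \<subseteq> range v"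
    and graph: "{xs @ [a] | xs a. xs \<in> A \<and> f xs = Some a} =
      {xs \<in> Kn (Suc n). dpsat v ac relG relR \<phi> (env (Suc n) pK xs) pG pR}"
    using assms(3) unfolding dp_definable_env by (elim exE conjE)
  define sat where "sat e = dpsat v ac relG relR \<phi> e pG pR" for e
  let ?e = "env n pK"
  have sat_iff: "sat ((?e xs)(n := a)) \<longleftrightarrow> xs \<in> A \<and> f xs = Some a" if "xs \<in> Kn n" for xs a
  proof -
    have "xs @ [a] \<in> Kn (Suc n)" using that by (simp add: Kn_def)
    then have "sat ((?e xs)(n := a)) \<longleftrightarrow> xs @ [a] \<in> {xs @ [a] | xs a. xs \<in> A \<and> f xs = Some a}"
      unfolding graph sat_def env_snoc[OF that, symmetric] by simp
    then show ?thesis by simp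
  qed
  obtain T0 where T0: "finite T0" "\<forall>e e' eG eR. (\<forall>t\<in>T0. sim (evalK e t) (evalK e' t)) \<longrightarrow>
    dpsat v ac relG relR \<phi> e eG eR = dpsat v ac relG relR \<phi> e' eG eR"
    using dpsat_sim_invariant[OF ac, where \<phi> = \<phi> and relG = relG and relR = relR] by (elim exE conjE)
  define T where "T = insert (KVar n) T0"
  have T: "finite T" "KVar n \<in> T" using T0 by (auto simp: T_def)
  have inv: "\<forall>e e' eG eR. (\<forall>t\<in>T. sim (evalK e t) (evalK e' t)) \<longrightarrow>
    dpsat v ac relG relR \<phi> e eG eR = dpsat v ac relG relR \<phi> e' eG eR"
    using T0(2) unfolding T_def by simp
  define G where "G = terms.derivs (kpoly n ` T)"
  obtain D where D: "kpoly n ` T \<subseteq> terms.PF n D" using finite_kpoly_PF[OF T(1)] by blast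
  have G: "finite G" "G \<subseteq> terms.PF n D" "kpoly n ` T \<subseteq> G"
    unfolding G_def using terms.finite_derivs[OF finite_imageI[OF T(1)] D] terms.derivs_PF[OF D]
    by (auto intro: terms.subset_derivs[THEN subsetD])
  obtain G' D' where G': "finite G'" "G \<subseteq> G'" "G' \<subseteq> terms.PF n D'"
    and tracks: "\<forall>B f. terms.zero_pattern G' B f \<longrightarrow>
      (\<exists>h\<in>G \<inter> terms.PF n (Suc D). \<exists>x\<in>B. h x \<noteq> 0 \<and> poly (h x) (f x) = 0) \<longrightarrow> terms.tracks n G B f"
    using terms.root_tracks[OF G(1,2), of D] by (elim exE conjE)
  have "\<forall>g\<in>G'. \<exists>t. \<forall>e a. evalK (e(n := a)) t = poly (g e) a"
    using PF_term G'(3) by blast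
  then obtain tm where tm: "\<And>g e a. g \<in> G' \<Longrightarrow> evalK (e(n := a)) (tm g) = poly (g e) a"
    by metis
  define A0 where "A0 = {xs \<in> A. f xs \<noteq> None}"
  define val where "val xs = the (f xs)" for xs
  define piece where "piece P = {xs \<in> A0. \<forall>t\<in>tm ` G'. evalK ((?e xs)(n := val xs)) t = 0 \<longleftrightarrow> t \<in> P}" for P
  have definable: "dp_definable v ac relG relR n (piece P)" for P
  proof -
    obtain \<psi> where \<psi>: "\<forall>e eG eR. dpsat v ac relG relR \<psi> e eG eR \<longleftrightarrow>
        (\<forall>t\<in>tm ` G'. evalK e t = 0 \<longleftrightarrow> t \<in> P)"
      using exists_zero_pattern_formula[where v = v and ac = ac and relG = relG and relR = relR and P = P, OF finite_imageI[OF G'(1), of tm]] by (elim exE)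
    \<comment> \<open>The formula \<open>\<phi>\<close> pins variable \<open>n\<close> to the value
      of \<open>f\<close>, so an existential quantifier expresses a condition on the graph point
      over \<open>xs\<close>.\<close>
    have "xs \<in> piece P \<longleftrightarrow> dpsat v ac relG relR (FExK n (FAnd \<phi> \<psi>)) (?e xs) pG pR" if "xs \<in> Kn n" for xs
    proof -
      have "dpsat v ac relG relR (FExK n (FAnd \<phi> \<psi>)) (?e xs) pG pR \<longleftrightarrow>
          (\<exists>a. sat ((?e xs)(n := a)) \<and> (\<forall>t\<in>tm ` G'. evalK ((?e xs)(n := a)) t = 0 \<longleftrightarrow> t \<in> P))"
        unfolding sat_def by (simp only: dpsat.simps \<psi>)
      also have "\<dots> \<longleftrightarrow> xs \<in> piece P"
        unfolding sat_iff[OF that] piece_def A0_def val_def by (cases "f xs") simp_all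
      finally show ?thesis ..
    qed
    moreover have "piece P \<subseteq> Kn n" using A by (auto simp: piece_def A0_def)
    ultimately have "piece P = {xs \<in> Kn n. dpsat v ac relG relR (FExK n (FAnd \<phi> \<psi>)) (?e xs) pG pR}"
      by blast
    then show ?thesis unfolding dp_definable_env using pG by blast
  qed
  have "continuous_on_P1 v n (piece P) f" for P
    unfolding continuous_on_P1_def
  proof (intro allI impI)
    fix W assume W: "P1_open v W"
    let ?B = "?e ` piece P"
    define F where "F e = val (map e [0..<n])" for e
    have in_Kn: "xs \<in> Kn n" "xs \<in> A0" if "xs \<in> piece P" for xs
      using that A by (auto simp: piece_def A0_def)
    have F: "F (?e xs) = val xs" if "xs \<in> piece P" for xs
      unfolding F_def map_env[OF in_Kn(1)[OF that]] ..
    have f_val: "f xs = Some (val xs)" if "xs \<in> piece P" for xs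
      using in_Kn(2)[OF that] by (auto simp: A0_def val_def)
    have pat: "terms.zero_pattern G' ?B F"
      unfolding terms.zero_pattern_def
    proof (intro ballI impI)
      fix g x x' assume g: "g \<in> G'" and "x \<in> ?B" "x' \<in> ?B" and zero: "poly (g x) (F x) = 0"
      then obtain xs ys where xs: "xs \<in> piece P" "x = ?e xs" and ys: "ys \<in> piece P" "x' = ?e ys" by blast
      have "poly (g (?e zs)) (val zs) = 0 \<longleftrightarrow> tm g \<in> P" if "zs \<in> piece P" for zs
        using that g tm[OF g] unfolding piece_def by auto
      then show "poly (g x') (F x') = 0" using zero xs ys F by simp
    qed
    have "terms.tracks n G ?B F"
    proof (cases "piece P = {}")
      case True
      then show ?thesis by (simp add: terms.tracks_def)
    next
      case False
      then obtain xs where xs: "xs \<in> piece P" by blast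
      have sat: "dpsat v ac relG relR \<phi> ((?e xs)(n := a)) pG pR \<longleftrightarrow> a = val xs" for a
        using sat_iff[OF in_Kn(1)[OF xs], of a] f_val[OF xs] in_Kn(2)[OF xs]
        by (auto simp: sat_def A0_def)
      have "val xs \<in> terms.roots G (?e xs)"
        unfolding G_def by (rule definable_function_value_is_root[OF inv T, where eG = pG and eR = pR]) (simp_all add: sat)
      then obtain h where h: "h \<in> G" "h (?e xs) \<noteq> 0 \<and> poly (h (?e xs)) (F (?e xs)) = 0"
        unfolding F[OF xs] terms.roots_def by blast
      moreover have "h \<in> terms.PF n (Suc D)" using h(1) G(2) terms.PF_mono[of D "Suc D" n] by auto
      ultimately have "\<exists>h\<in>G \<inter> terms.PF n (Suc D). \<exists>x\<in>?B. h x \<noteq> 0 \<and> poly (h x) (F x) = 0"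
        using xs by blast
      with tracks[THEN spec, THEN spec, THEN mp, OF pat] show ?thesis by (rule mp)
    qed
    note near = this[unfolded terms.tracks_def, THEN bspec, OF imageI, THEN spec, THEN mp,
        OF _ vtends_term_funs, THEN spec]
    have "\<exists>\<gamma>::real. \<forall>ys\<in>piece P. (\<forall>i<n. v (ys ! i - xs ! i) > ereal \<gamma>) \<longrightarrow> ys \<in> {xs \<in> piece P. f xs \<in> W}"
      if xs: "xs \<in> {xs \<in> piece P. f xs \<in> W}" for xs
    proof -
      \<comment> \<open>On the piece \<open>f\<close> is finite, so only the affine chart of
        \<open>W\<close> matters.\<close>
      have "xs \<in> piece P" "Some (val xs) \<in> W" using xs f_val by auto
      then obtain \<gamma> :: real where \<gamma>: "\<And>b. v (b - val xs) > ereal \<gamma> \<Longrightarrow> Some b \<in> W"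
        using W unfolding P1_open_def K_open_def by blast
      have "eventually (\<lambda>e. e \<in> ?B \<longrightarrow> (\<exists>c. v (c - val xs) > ereal \<gamma> \<and>
          (\<forall>g\<in>G. sim (poly (g (?e xs)) (val xs)) (poly (g e) c)))) (env_nhds (?e xs))"
        using near[OF \<open>xs \<in> piece P\<close>, of \<gamma>] unfolding F[OF \<open>xs \<in> piece P\<close>] .
      from eventually_env_nhdsD[OF this] obtain \<delta> :: real where
        \<delta>: "\<forall>ys\<in>Kn n. (\<forall>i<n. v (ys ! i - xs ! i) > ereal \<delta>) \<longrightarrow> ?e ys \<in> ?B \<longrightarrow>
          (\<exists>c. v (c - val xs) > ereal \<gamma> \<and> (\<forall>g\<in>G. sim (poly (g (?e xs)) (val xs)) (poly (g (?e ys)) c)))"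
        by (elim exE)
      have "f ys \<in> W" if ys: "ys \<in> piece P" and close: "\<forall>i<n. v (ys ! i - xs ! i) > ereal \<delta>" for ys
      proof -
        obtain c where c: "v (c - val xs) > ereal \<gamma>"
          "\<forall>g\<in>G. sim (poly (g (?e xs)) (val xs)) (poly (g (?e ys)) c)"
          using \<delta>[THEN bspec, OF in_Kn(1)[OF ys], THEN mp, OF close, THEN mp, OF imageI, OF ys]
          by (elim exE conjE)
        have "\<forall>t\<in>T. sim (evalK ((?e xs)(n := val xs)) t) (evalK ((?e ys)(n := c)) t)"
          using c(2) G(3) unfolding poly_kpoly[symmetric] by blast
        \<comment> \<open>The nearby \<open>c\<close> satisfies the formula of the graph, which
          identifies it with the value of \<open>f\<close> at \<open>ys\<close>.\<close>
        from inv[THEN spec, THEN spec, THEN spec, THEN spec, THEN mp, OF this]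
        have "sat ((?e ys)(n := c))"
          using sat_iff[OF in_Kn(1)[OF \<open>xs \<in> piece P\<close>], of "val xs"] f_val[OF \<open>xs \<in> piece P\<close>]
            in_Kn(2)[OF \<open>xs \<in> piece P\<close>] by (simp add: sat_def A0_def)
        then have "f ys = Some c" using sat_iff[OF in_Kn(1)[OF ys]] by blast
        then show ?thesis using \<gamma>[OF c(1)] by simp
      qed
      then show ?thesis by blast
    qed
    then show "\<exists>U. Kn_open v n U \<and> {xs \<in> piece P. f xs \<in> W} = U \<inter> piece P"
      using in_Kn(1) by (intro relatively_open) auto
  qed
  with definable have "\<forall>C\<in>piece ` Pow (tm ` G'). dp_definable v ac relG relR n C \<and> continuous_on_P1 v n C f"
    by simp
  with pattern_partition[OF finite_imageI[OF G'(1), of tm] piece_def] show ?thesis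
    unfolding A0_def[symmetric] by (intro exI[of _ "piece ` Pow (tm ` G')"] conjI)
qed

lemma continuous_on_P1_subset:
  assumes "continuous_on_P1 v n B f" "C \<subseteq> B"
  shows "continuous_on_P1 v n C f"
  unfolding continuous_on_P1_def
proof (intro allI impI)
  fix W assume "P1_open v W"
  then obtain U where "Kn_open v n U" "{xs \<in> B. f xs \<in> W} = U \<inter> B"
    using assms(1) unfolding continuous_on_P1_def by blast
  then show "\<exists>U. Kn_open v n U \<and> {xs \<in> C. f xs \<in> W} = U \<inter> C"
    using assms(2) by (intro exI[of _ U]) blast
qed

lemma continuous_on_P1_const:
  assumes "B \<subseteq> Kn n" "\<And>xs. xs \<in> B \<Longrightarrow> f xs = c"
  shows "continuous_on_P1 v n B f"
  unfolding continuous_on_P1_def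
proof (intro allI impI)
  fix W
  show "\<exists>U. Kn_open v n U \<and> {xs \<in> B. f xs \<in> W} = U \<inter> B"
    using assms by (intro relatively_open) auto
qed

theorem definable_piecewise_continuous:
  fixes ac :: "'k \<Rightarrow> 'r::field"
  assumes ac: "\<forall>a b. sim a b \<longrightarrow> ac a = ac b" and A: "A \<subseteq> Kn n"
    and f: "dp_definable_P1_fun v ac relG relR n A f"
  shows "\<exists>Bs :: 'k list set list.
           \<Union> (set Bs) = A \<and>
           (\<forall>i j. i < j \<and> j < length Bs \<longrightarrow> Bs ! i \<inter> Bs ! j = {}) \<and>
           (\<forall>B\<in>set Bs. dp_definable v ac relG relR n B \<and> locally_closed v n B \<and>
                        continuous_on_P1 v n B f)"
proof -
  \<comment> \<open>The graph formula describes affine values only; on the rest \<open>f\<close> is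
    constantly the point at infinity.\<close>
  define N where "N = {xs \<in> A. f xs = None}"
  have N: "dp_definable v ac relG relR n N" and
    graph: "dp_definable v ac relG relR (Suc n) {xs @ [a] | xs a. xs \<in> A \<and> f xs = Some a}"
    using f unfolding dp_definable_P1_fun_def N_def by auto
  obtain \<B> where \<B>: "finite \<B>" "\<Union>\<B> = {xs \<in> A. f xs \<noteq> None}" "disjoint \<B>"
    and \<B>_good: "\<forall>C\<in>\<B>. dp_definable v ac relG relR n C \<and> continuous_on_P1 v n C f"
    using definable_function_continuous_partition[OF ac A graph] by (elim exE conjE)
  let ?\<B> = "insert N \<B>"
  have N_disj: "N \<inter> C = {}" if "C \<in> \<B>" for C
    using that \<B>(2) unfolding N_def by blast
  have B_disj: "disjoint ?\<B>"
    using \<B>(3) N_disj unfolding disjoint_def by blast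
  have good: "dp_definable v ac relG relR n C \<and> continuous_on_P1 v n C f" if "C \<in> ?\<B>" for C
  proof (cases "C = N")
    case True
    have "N \<subseteq> Kn n" using A by (auto simp: N_def)
    then have "continuous_on_P1 v n N f" by (rule continuous_on_P1_const) (simp add: N_def)
    then show ?thesis using True N by simp
  next
    case False
    then show ?thesis using that \<B>_good by simp
  qed
  have "\<forall>C\<in>?\<B>. \<exists>\<C>. finite \<C> \<and> \<Union>\<C> = C \<and> disjoint \<C> \<and>
      (\<forall>E\<in>\<C>. dp_definable v ac relG relR n E \<and> locally_closed v n E)"
  proof
    fix C assume "C \<in> ?\<B>"
    then have "dp_definable v ac relG relR n C" using good by simp
    from definable_locally_closed_partition[OF ac this]
    show "\<exists>\<C>. finite \<C> \<and> \<Union>\<C> = C \<and> disjoint \<C> \<and>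
      (\<forall>E\<in>\<C>. dp_definable v ac relG relR n E \<and> locally_closed v n E)" .
  qed
  then obtain \<C> where \<C>: "\<forall>C\<in>?\<B>. finite (\<C> C) \<and> \<Union>(\<C> C) = C \<and> disjoint (\<C> C) \<and>
      (\<forall>E\<in>\<C> C. dp_definable v ac relG relR n E \<and> locally_closed v n E)"
    unfolding bchoice_iff by (elim exE)
  \<comment> \<open>Continuity survives restriction while local closedness need not, so the locally
    closed refinement comes last.\<close>
  define \<E> where "\<E> = (\<Union>C\<in>?\<B>. \<C> C)"
  have \<C>_un: "\<Union>(\<C> C) = C" and \<C>_disj: "disjoint (\<C> C)" and \<C>_fin: "finite (\<C> C)"
    and \<C>_good: "\<forall>E\<in>\<C> C. dp_definable v ac relG relR n E \<and> locally_closed v n E"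
    if "C \<in> ?\<B>" for C
    using bspec[OF \<C> that] by simp_all
  have "finite \<E>" unfolding \<E>_def
  proof (rule finite_UN_I)
    show "finite ?\<B>" using \<B>(1) by simp
  qed (rule \<C>_fin)
  then obtain Bs where Bs: "set Bs = \<E>" "distinct Bs"
    using finite_distinct_list by blast
  have "\<Union>\<E> = (\<Union>C\<in>?\<B>. \<Union>(\<C> C))" unfolding \<E>_def by blast
  also have "\<dots> = \<Union>?\<B>" using \<C>_un by simp
  also have "\<dots> = A" unfolding Union_insert \<B>(2) N_def by blast
  finally have union: "\<Union>(set Bs) = A" using Bs(1) by simp
  have disj: "E \<inter> E' = {}" if E: "E \<in> \<E>" and E': "E' \<in> \<E>" and neq: "E \<noteq> E'" for E E'
  proof -
    obtain C where C: "C \<in> ?\<B>" "E \<in> \<C> C" using E unfolding \<E>_def by (rule UN_E)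
    obtain C' where C': "C' \<in> ?\<B>" "E' \<in> \<C> C'" using E' unfolding \<E>_def by (rule UN_E)
    show ?thesis
    proof (cases "C = C'")
      case True
      then show ?thesis using \<C>_disj[OF C(1)] C C' neq unfolding disjoint_def by blast
    next
      case False
      then have "C \<inter> C' = {}" using B_disj C C' unfolding disjoint_def by blast
      moreover have "E \<subseteq> C" "E' \<subseteq> C'" using \<C>_un[OF C(1)] \<C>_un[OF C'(1)] C C' by blast+
      ultimately show ?thesis by blast
    qed
  qed
  have "\<forall>i j. i < j \<and> j < length Bs \<longrightarrow> Bs ! i \<inter> Bs ! j = {}"
  proof (intro allI impI, elim conjE)
    fix i j assume "i < j" "j < length Bs"
    then show "Bs ! i \<inter> Bs ! j = {}"
      using Bs by (intro disj) (auto simp: nth_eq_iff_index_eq)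
  qed
  moreover have "dp_definable v ac relG relR n E \<and> locally_closed v n E \<and> continuous_on_P1 v n E f"
    if E: "E \<in> set Bs" for E
  proof -
    obtain C where C: "C \<in> ?\<B>" "E \<in> \<C> C" using E unfolding Bs(1) \<E>_def by (rule UN_E)
    then have "E \<subseteq> C" using \<C>_un[OF C(1)] by blast
    with good[OF C(1)] have "continuous_on_P1 v n E f" using continuous_on_P1_subset[of n C f E] by simp
    then show ?thesis using \<C>_good[OF C(1)] C(2) by simp
  qed
  ultimately show ?thesis using union by (intro exI[of _ Bs]) simp
qed

end

section \<open>From the given structure to the abstract setting\<close>

text \<open>The residue map sends integers to integers, nonzero in a residue field of characteristic
  zero, so positive integers are units. For \<open>sim a b\<close> with \<open>b\<close> nonzero,
  \<open>a / b\<close> is a unit with residue 1, hence with angular component 1.\<close>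

lemma henselian_rank_one_ac_fieldD:
  fixes v :: "'k::field_char_0 \<Rightarrow> ereal" and res :: "'k \<Rightarrow> 'r::field_char_0"
  assumes K: "henselian_rank_one_ac_field v res ac"
  shows "henselian_valuation v" and "\<forall>a b. henselian_valuation.sim v a b \<longrightarrow> ac a = ac b"
proof -
  have rank: "rank_one_valuation v" and res: "residue_map v res"
    and ac: "angular_component v res ac" and hens: "henselian v"
    using K by (auto simp: henselian_rank_one_ac_field_def)
  have mult: "v (x * y) = v x + v y" and add: "min (v x) (v y) \<le> v (x + y)"
    and inf: "v x = \<infinity> \<longleftrightarrow> x = 0" and fin: "x \<noteq> 0 \<Longrightarrow> \<exists>r::real. v x = ereal r" for x y
    using rank by (auto simp: rank_one_valuation_def)
  have v1: "v 1 = 0"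
    using mult[of 1 1] fin[of 1] by auto
  have res_add: "res (x + y) = res x + res y" and res_0: "res x = 0 \<longleftrightarrow> v x > 0"
    if "v x \<ge> 0" "v y \<ge> 0" for x y
    using res that by (auto simp: residue_map_def valuation_ring_def)
  have res1: "res 1 = 1" using res by (simp add: residue_map_def)
  have nat: "v (of_nat n) \<ge> 0 \<and> res (of_nat n) = of_nat n" for n
  proof (induction n)
    case 0
    have "v 0 = \<infinity>" using inf by simp
    then show ?case using res_0[of 0 0] by simp
  next
    case (Suc n)
    then have "v (1 + of_nat n) \<ge> 0" using add[of 1 "of_nat n"] v1 by (auto simp: min_def split: if_splits)
    then show ?case using Suc res_add[of 1 "of_nat n"] v1 res1 by simp
  qed
  show hv: "henselian_valuation v"
  proof
    fix n :: nat assume "n > 0"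
    then have "res (of_nat n) \<noteq> 0" using nat[of n] by simp
    then show "v (of_nat n) = 0" using res_0[of "of_nat n" 0] nat[of n] inf[of 0] by auto
  qed (use rank hens in auto)
  interpret henselian_valuation v by (rule hv)
  show "\<forall>a b. sim a b \<longrightarrow> ac a = ac b"
  proof (intro allI impI)
    fix a b assume sim: "sim a b"
    show "ac a = ac b"
    proof (cases "a = b \<or> b = 0")
      case True
      then show ?thesis using sim sim_0 by auto
    next
      case False
      then have b: "b \<noteq> 0" and gt: "v (a - b) > v b" using sim sim_v[OF sim] by (auto simp: sim_def)
      define u where "u = a / b"
      have a: "a = b * u" using b by (simp add: u_def)
      have "v (b * 1) < v (b * (u - 1))" using gt a by (simp add: right_diff_distrib)
      then have u1: "v (u - 1) > 0" using b v_cancel_less[of b 1 "u - 1"] by simp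
      have vu: "v u = 0" using v_eq_if_close[of 1 u] u1 by (simp add: v_diff_commute[of 1])
      have "res u = res (u - 1) + res 1" using res_add[of "u - 1" 1] u1 by simp
      also have "\<dots> = 1" using res_0[of "u - 1" 0] u1 res1 by simp
      finally have "ac u = 1" using ac vu by (simp add: angular_component_def)
      then show ?thesis using ac a by (simp add: angular_component_def)
    qed
  qed
qed

theorem theorem1p1:
  fixes v :: "'k::field_char_0 \<Rightarrow> ereal"
    and res :: "'k \<Rightarrow> 'r::field_char_0"
    and ac :: "'k \<Rightarrow> 'r"
    and relG :: "'i \<Rightarrow> ereal list set"
    and relR :: "'j \<Rightarrow> 'r list set"
    and n :: nat
    and A :: "'k list set"
    and f :: "'k list \<Rightarrow> 'k option"
  assumes "henselian_rank_one_ac_field v res ac"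
    and "A \<subseteq> Kn n"
    and "dp_definable v ac relG relR n A"
    and "dp_definable_P1_fun v ac relG relR n A f"
  shows "\<exists>Bs :: 'k list set list.
           \<Union> (set Bs) = A \<and>
           (\<forall>i j. i < j \<and> j < length Bs \<longrightarrow> Bs ! i \<inter> Bs ! j = {}) \<and>
           (\<forall>B\<in>set Bs. dp_definable v ac relG relR n B \<and> locally_closed v n B \<and>
                        continuous_on_P1 v n B f)"
  using henselian_valuation.definable_piecewise_continuous[OF
      henselian_rank_one_ac_fieldD[OF assms(1)] assms(2,4)] .

end
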